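(* Let $M_p$ be a weight sequence satisfying $(M.1)$, $(M.2)'$, $(QA)$ and $p!\prec M_p$. Let $\Omega\subseteq\mathbb{R}^d$ be open. For every bounded set $B$ in $\mathcal{E}'^{(M_p)}(\Omega)$ there are a compact set $K\subset\Omega$ and measures $\mu_\alpha(f)\in C'(K)$, $\alpha\in\mathbb{N}^d$, $f\in B$, such that $$\sup_{f\in B}\sup_{\alpha\in\mathbb{N}^d}\frac{\|\mu_\alpha(f)\|_{C'(K)}M_\alpha}{h^{|\alpha|}}<\infty$$ for some $h>0$ and $$f=\sum_{\alpha\in\mathbb{N}^d}(\mu_\alpha(f))^{(\alpha)},\qquad f\in B.$$
   Context: $\mathbb{N}=\{0,1,2,\dots\}$. A weight sequence is a sequence $(M_p)_{p\in\mathbb{N}}$ of positive reals with $M_0=1$ and $m_p:=M_p/M_{p-1}\to\infty$. Conditions: $(M.1)$ $M_p^2\le M_{p-1}M_{p+1}$ for $p\ge1$; $(M.2)'$ there are $A,H\ge1$ with $M_{p+1}\le AH^{p+1}M_p$ for all $p\in\mathbb{N}$; $(QA)$ $\sum_{p\ge1}1/m_p=\infty$. $p!\prec M_p$ means that for every $h>0$ there is $C>0$ with $p!\le Ch^pM_p$ for all $p$. Put $M_\alpha=M_{|\alpha|}$ for $\alpha\in\mathbb{N}^d$. For a regular compact set $K\subset\mathbb{R}^d$ (i.e. $\overline{\operatorname{int}K}=K$) and $h>0$, $\mathcal{E}^{M_p,h}(K)$ is the Banach space of all $\varphi\in C^\infty(K)$ (smooth on $\operatorname{int}K$, all derivatives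 extending continuously to $K$) with $\|\varphi\|_{K,h}:=\sup_{\alpha}\sup_{x\in K}|\varphi^{(\alpha)}(x)|/(h^{|\alpha|}M_\alpha)<\infty$. For $\Omega\subseteq\mathbb{R}^d$ open, $\mathcal{E}^{(M_p)}(\Omega)=\varprojlim_{K\Subset\Omega}\varprojlim_{h\to0^+}\mathcal{E}^{M_p,h}(K)$ as a locally convex space, and $\mathcal{E}'^{(M_p)}(\Omega)$ is its topological dual with the strong topology. $C'(K)$ is the dual of the Banach space $C(K)$, i.e. the space of complex Borel measures on $K$ with the total variation norm. The identity $f=\sum_\alpha(\mu_\alpha(f))^{(\alpha)}$ means $\langle f,\varphi\rangle=\sum_{\alpha}(-1)^{|\alpha|}\int_K\varphi^{(\alpha)}\,d\mu_\alpha(f)$ for all $\varphi\in\mathcal{E}^{(M_p)}(\Omega)$. *)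

theory Defs
  imports "HOL-Analysis.Analysis"
begin

section \<open>Weight sequences\<close>

text \<open>\<open>quot M p\<close> is \<open>m\<^sub>p = M\<^sub>p / M\<^sub>p\<^sub>-\<^sub>1\<close>; only the values for \<open>p \<ge> 1\<close> are used.\<close>

definition quot :: "(nat \<Rightarrow> real) \<Rightarrow> nat \<Rightarrow> real" where
  "quot M p = M p / M (p - 1)"

definition weight_sequence :: "(nat \<Rightarrow> real) \<Rightarrow> bool" where
  "weight_sequence M \<longleftrightarrow>
     (\<forall>p. M p > 0) \<and> M 0 = 1 \<and> filterlim (quot M) at_top sequentially"

definition cond_M1 :: "(nat \<Rightarrow> real) \<Rightarrow> bool" where
  "cond_M1 M \<longleftrightarrow> (\<forall>p\<ge>1. (M p)\<^sup>2 \<le> M (p - 1) * M (p + 1))"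

definition cond_M2' :: "(nat \<Rightarrow> real) \<Rightarrow> bool" where
  "cond_M2' M \<longleftrightarrow> (\<exists>A\<ge>1. \<exists>H\<ge>1. \<forall>p. M (p + 1) \<le> A * H ^ (p + 1) * M p)"

definition cond_QA :: "(nat \<Rightarrow> real) \<Rightarrow> bool" where
  "cond_QA M \<longleftrightarrow> \<not> summable (\<lambda>p. 1 / quot M (Suc p))"

definition fact_prec :: "(nat \<Rightarrow> real) \<Rightarrow> bool" where
  "fact_prec M \<longleftrightarrow> (\<forall>h>0. \<exists>C>0. \<forall>p. fact p \<le> C * h ^ p * M p)"


section \<open>Smooth functions and their partial derivatives\<close>

definition partial :: "'d::finite \<Rightarrow> (real ^ 'd \<Rightarrow> complex) \<Rightarrow> real ^ 'd \<Rightarrow> complex" where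
  "partial i \<phi> x = vector_derivative (\<lambda>t. \<phi> (x + t *\<^sub>R axis i 1)) (at 0)"

definition partials :: "'d::finite list \<Rightarrow> (real ^ 'd \<Rightarrow> complex) \<Rightarrow> real ^ 'd \<Rightarrow> complex" where
  "partials is \<phi> = foldr partial is \<phi>"

definition smooth_on :: "(real ^ 'd::finite) set \<Rightarrow> (real ^ 'd \<Rightarrow> complex) \<Rightarrow> bool" where
  "smooth_on \<Omega> \<phi> \<longleftrightarrow>
     (\<forall>is. continuous_on \<Omega> (partials is \<phi>) \<and>
       (\<forall>i. \<forall>x\<in>\<Omega>. (\<lambda>t. partials is \<phi> (x + t *\<^sub>R axis i 1)) differentiable (at 0)))"

definition mi_size :: "nat ^ 'd::finite \<Rightarrow> nat" where
  "mi_size \<alpha> = (\<Sum>i\<in>UNIV. \<alpha> $ i)"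

text \<open>The index type \<open>'d\<close> carries no order, so \<open>mderiv \<alpha>\<close> picks some order in which the
  partial derivatives are taken. For smooth functions on an open set the choice is immaterial,
  by symmetry of mixed partial derivatives.\<close>

definition mderiv :: "nat ^ 'd::finite \<Rightarrow> (real ^ 'd \<Rightarrow> complex) \<Rightarrow> real ^ 'd \<Rightarrow> complex" where
  "mderiv \<alpha> \<phi> = partials (SOME is. \<forall>i. count_list is i = \<alpha> $ i) \<phi>"


section \<open>Locally convex spaces of complex-valued functions\<close>

text \<open>Both the ultradifferentiable functions and the functionals on them are complex-valued
  functions, so a vector space here is a set \<open>V\<close> of functions with pointwise operations.\<close>

text \<open>The topology on \<open>V\<close> generated by the set \<open>P\<close> of seminorms.\<close>

definition seminorm_topology ::
    "('x \<Rightarrow> complex) set \<Rightarrow> (('x \<Rightarrow> complex) \<Rightarrow> real) set \<Rightarrow> ('x \<Rightarrow> complex) topology" where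
  "seminorm_topology V P = topology_generated_by
     (insert V {{g \<in> V. p (\<lambda>t. g t - f t) < e} | f p e. f \<in> V \<and> p \<in> P \<and> e > 0})"

definition vn_bounded :: "('x \<Rightarrow> complex) topology \<Rightarrow> ('x \<Rightarrow> complex) set \<Rightarrow> bool" where
  "vn_bounded T B \<longleftrightarrow> B \<subseteq> topspace T \<and>
     (\<forall>U. openin T U \<and> (\<lambda>_. 0) \<in> U \<longrightarrow>
       (\<exists>r>0. B \<subseteq> (\<lambda>f t. complex_of_real r * f t) ` U))"

text \<open>The topological dual. Functionals are set to zero off \<open>topspace T\<close>, so that
  equality of functionals is equality on the space.\<close>

definition dual_space :: "('x \<Rightarrow> complex) topology \<Rightarrow> (('x \<Rightarrow> complex) \<Rightarrow> complex) set" where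
  "dual_space T = {f.
     (\<forall>\<phi>\<in>topspace T. \<forall>\<psi>\<in>topspace T. f (\<lambda>x. \<phi> x + \<psi> x) = f \<phi> + f \<psi>) \<and>
     (\<forall>c. \<forall>\<phi>\<in>topspace T. f (\<lambda>x. c * \<phi> x) = c * f \<phi>) \<and>
     continuous_map T euclidean f \<and>
     (\<forall>\<phi>. \<phi> \<notin> topspace T \<longrightarrow> f \<phi> = 0)}"

definition strong_dual :: "('x \<Rightarrow> complex) topology \<Rightarrow> (('x \<Rightarrow> complex) \<Rightarrow> complex) topology" where
  "strong_dual T = seminorm_topology (dual_space T)
     {(\<lambda>f. SUP \<phi>\<in>S. cmod (f \<phi>)) | S. vn_bounded T S \<and> S \<noteq> {}}"


section \<open>Ultradifferentiable functions of Beurling type\<close>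

definition regular_compact :: "('a::topological_space) set \<Rightarrow> bool" where
  "regular_compact K \<longleftrightarrow> compact K \<and> closure (interior K) = K"

definition um_norm ::
    "(nat \<Rightarrow> real) \<Rightarrow> (real ^ 'd::finite) set \<Rightarrow> real \<Rightarrow> (real ^ 'd \<Rightarrow> complex) \<Rightarrow> ennreal" where
  "um_norm M K h \<phi> =
     (SUP \<alpha>. SUP x\<in>K. ennreal (cmod (mderiv \<alpha> \<phi> x) / (h ^ mi_size \<alpha> * M (mi_size \<alpha>))))"

text \<open>The projective limit over the regular compact sets \<open>K\<close> in \<open>\<Omega>\<close> and \<open>h > 0\<close>:
  a compatible family of elements of the spaces \<open>\<E>\<^bsup>M,h\<^esup>(K)\<close> is the family of restrictions of
  one smooth function on \<open>\<Omega>\<close>, which is extended by zero so that functions on \<open>\<Omega>\<close> have a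
  unique representative. On \<open>K\<close> the derivatives of this function are the
  continuous extensions of its derivatives on the interior of \<open>K\<close>. The projective limit
  topology is generated by the norms of the individual spaces.\<close>

definition beurling_space ::
    "(nat \<Rightarrow> real) \<Rightarrow> (real ^ 'd::finite) set \<Rightarrow> (real ^ 'd \<Rightarrow> complex) set" where
  "beurling_space M \<Omega> = {\<phi>. smooth_on \<Omega> \<phi> \<and> (\<forall>x. x \<notin> \<Omega> \<longrightarrow> \<phi> x = 0) \<and>
     (\<forall>K h. regular_compact K \<and> K \<subseteq> \<Omega> \<and> h > 0 \<longrightarrow> um_norm M K h \<phi> < \<infinity>)}"

definition beurling_topology ::
    "(nat \<Rightarrow> real) \<Rightarrow> (real ^ 'd::finite) set \<Rightarrow> (real ^ 'd \<Rightarrow> complex) topology" where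
  "beurling_topology M \<Omega> = seminorm_topology (beurling_space M \<Omega>)
     {(\<lambda>\<phi>. enn2real (um_norm M K h \<phi>)) | K h. regular_compact K \<and> K \<subseteq> \<Omega> \<and> h > 0}"

lemma topspace_seminorm_topology [simp]: "topspace (seminorm_topology V P) = V"
  unfolding seminorm_topology_def topology_generated_by_topspace by auto

lemma topspace_beurling_topology [simp]:
  "topspace (beurling_topology M \<Omega>) = beurling_space M \<Omega>"
  by (simp add: beurling_topology_def)

lemma topspace_strong_dual [simp]: "topspace (strong_dual T) = dual_space T"
  by (simp add: strong_dual_def)


section \<open>Complex Borel measures\<close>

abbreviation borel_subsets :: "('a::topological_space) set \<Rightarrow> 'a set set" where
  "borel_subsets K \<equiv> sets (restrict_space borel K)"

text \<open>Only the values of \<open>\<mu>\<close> on \<open>borel_subsets K\<close> matter.\<close>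

definition complex_measure_on :: "('a::topological_space) set \<Rightarrow> ('a set \<Rightarrow> complex) \<Rightarrow> bool" where
  "complex_measure_on K \<mu> \<longleftrightarrow>
     (\<forall>A. range A \<subseteq> borel_subsets K \<and> disjoint_family A \<longrightarrow>
       (\<lambda>n. \<mu> (A n)) sums \<mu> (\<Union>n::nat. A n))"

definition total_variation :: "('a::topological_space) set \<Rightarrow> ('a set \<Rightarrow> complex) \<Rightarrow> ennreal" where
  "total_variation K \<mu> =
     (SUP P\<in>{P. finite P \<and> partition_on K P \<and> P \<subseteq> borel_subsets K}.
       \<Sum>A\<in>P. ennreal (cmod (\<mu> A)))"

text \<open>The positive part of the Jordan decomposition of a real signed measure \<open>\<nu>\<close>; the
  negative part is the positive part of \<open>-\<nu>\<close>. Negative values of \<open>\<nu>\<close> are truncated to \<open>0 = \<nu> {}\<close>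
  by \<open>ennreal\<close>, which does not change the supremum.\<close>

definition positive_part :: "('a::topological_space) set \<Rightarrow> ('a set \<Rightarrow> real) \<Rightarrow> 'a measure" where
  "positive_part K \<nu> = measure_of K (borel_subsets K)
     (\<lambda>A. SUP E\<in>{E \<in> borel_subsets K. E \<subseteq> A}. ennreal (\<nu> E))"

definition complex_integral ::
    "('a::topological_space) set \<Rightarrow> ('a set \<Rightarrow> complex) \<Rightarrow> ('a \<Rightarrow> complex) \<Rightarrow> complex" where
  "complex_integral K \<mu> \<phi> =
     integral\<^sup>L (positive_part K (\<lambda>A. Re (\<mu> A))) \<phi> - integral\<^sup>L (positive_part K (\<lambda>A. - Re (\<mu> A))) \<phi>
     + \<i> * (integral\<^sup>L (positive_part K (\<lambda>A. Im (\<mu> A))) \<phi>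
          - integral\<^sup>L (positive_part K (\<lambda>A. - Im (\<mu> A))) \<phi>)"

end

theory Submission
  imports Defs
begin

text \<open>The space \<open>\<E>\<^bsup>(M)\<^esup>(\<Omega>)\<close> is metrizable, hence \<open>B\<close> is equicontinuous, bounded by a multiple of a
  single norm \<open>\<parallel>\<phi>\<parallel>\<^bsub>K,h\<^esub>\<close>. The normalised derivatives \<open>\<phi>\<^bsup>(\<alpha>)\<^esup> / (h\<^bsup>|\<alpha>|\<^esup> M\<^sub>\<alpha>)\<close> on \<open>K\<close> embed the space into the bounded
  functions on \<open>\<nat>\<^sup>d \<times> K\<close>; by the Hahn--Banach theorem each \<open>f \<in> B\<close> extends to these. The restriction of
  the extension to functions supported on \<open>{\<alpha>} \<times> K\<close> is given by a measure, by the Riesz representation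
  theorem, and \<open>f\<close> is the sum of these restrictions because the normalised derivatives tend to \<open>0\<close>
  as \<open>|\<alpha>| \<rightarrow> \<infinity>\<close>.\<close>

section \<open>Riesz representation on a compact metric space\<close>

text \<open>Hahn--Banach is carried out over the reals, for Re f only. The index set therefore
  carries a boolean coordinate separating real and imaginary parts, and the extension need not be
  complex linear: f is recovered from f \<phi> = Re (f \<phi>) - i Re (f (i \<phi>)). Functions on
  the index set are merely bounded; continuity matters only on a single slice, where Riesz is
  applied. Integrals against a complex measure are fixed through the Jordan parts of its real and
  imaginary part, whereas the Riesz construction yields two positive measures that need not be
  mutually singular. This forces a comparison of integrals for two decompositions of one signed
  measure. The \<alpha>-th measure has total variation at most 12 C divided by the weight of
  \<alpha>, where C is the equicontinuity constant of B. A factor 2 pays for passing between a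
  modulus and its two real parts; the factor 6 = 2 (1 + 2) stands for two real functionals of norm
  c, each split into a positive part of mass at most c and a negative part of mass at most 2 c. None
  of K, h and C depends on f, whence the uniform bound.\<close>

lemma open_eq_pos_continuous:
  fixes U :: "'a::metric_space set"
  assumes "open U"
  obtains f :: "'a \<Rightarrow> real"
  where "continuous_on UNIV f" "\<And>x. 0 \<le> f x" "\<And>x. 0 < f x \<longleftrightarrow> x \<in> U"
proof (cases "U = UNIV")
  \<comment> \<open>The distance to the empty set is 0 by convention, so the distance to the
    complement fails here.\<close>
  case True
  show ?thesis by (rule that[of "\<lambda>_. 1"]) (use True in auto)
next
  case False
  show ?thesis
  proof (rule that[of "\<lambda>x. infdist x (- U)"])
    show "continuous_on UNIV (\<lambda>x. infdist x (- U))" by (intro continuous_intros)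
    show "0 \<le> infdist x (- U)" for x by (rule infdist_nonneg)
    have "closed (- U)" "- U \<noteq> {}" using assms False by auto
    then show "0 < infdist x (- U) \<longleftrightarrow> x \<in> U" for x
      by (metis ComplI Compl_iff in_closed_iff_infdist_zero infdist_nonneg less_eq_real_def less_irrefl)
  qed
qed

lemma integrable_continuous_compact:
  fixes u :: "'a::metric_space \<Rightarrow> 'b::{banach, second_countable_topology}"
  assumes "compact K" "continuous_on K u" and P: "sets P = borel_subsets K" "emeasure P K < top"
  shows "integrable P u"
proof -
  have sp: "space P = K"
    using P(1) by (auto dest: sets_eq_imp_space_eq simp: space_restrict_space)
  interpret P: finite_measure P by standard (use P sp in auto)
  have "bounded (u ` K)" using assms by (simp add: compact_continuous_image compact_imp_bounded)
  then obtain b where "\<And>x. x \<in> K \<Longrightarrow> norm (u x) \<le> b" by (auto simp: bounded_iff)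
  moreover have "u \<in> borel_measurable (restrict_space borel K)"
    using assms(2) by (rule borel_measurable_continuous_on_restrict)
  then have "u \<in> borel_measurable P"
    using measurable_cong_sets[OF P(1) refl] by blast
  ultimately show ?thesis
    by (intro P.integrable_const_bound[of _ b]) (auto simp: sp)
qed

section \<open>Positive functionals and the outer measure they generate\<close>

text \<open>Only the cone of nonnegative functions is involved, because the positive part of a
  functional is first defined there by a supremum. Functions are total, so \<open>cong\<close>
  expresses that only the values on K count.\<close>

locale cone_functional =
  fixes K :: "'a::metric_space set" and I :: "('a \<Rightarrow> real) \<Rightarrow> real"
  assumes compact_K: "compact K"
    and nonneg: "continuous_on K u \<Longrightarrow> (\<And>x. x \<in> K \<Longrightarrow> 0 \<le> u x) \<Longrightarrow> 0 \<le> I u"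
    and add: "continuous_on K u \<Longrightarrow> (\<And>x. x \<in> K \<Longrightarrow> 0 \<le> u x) \<Longrightarrow>
       continuous_on K v \<Longrightarrow> (\<And>x. x \<in> K \<Longrightarrow> 0 \<le> v x) \<Longrightarrow> I (\<lambda>x. u x + v x) = I u + I v"
    and scale: "continuous_on K u \<Longrightarrow> (\<And>x. x \<in> K \<Longrightarrow> 0 \<le> u x) \<Longrightarrow> 0 \<le> c \<Longrightarrow>
       I (\<lambda>x. c * u x) = c * I u"
    and cong: "continuous_on K u \<Longrightarrow> (\<And>x. x \<in> K \<Longrightarrow> u x = v x) \<Longrightarrow> I u = I v"
begin

lemma mono:
  assumes "continuous_on K u" "continuous_on K v" "\<And>x. x \<in> K \<Longrightarrow> 0 \<le> u x" "\<And>x. x \<in> K \<Longrightarrow> u x \<le> v x"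
  shows "I u \<le> I v"
proof -
  have "I v = I (\<lambda>x. u x + (v x - u x))" by (rule cong) (use assms in auto)
  also have "\<dots> = I u + I (\<lambda>x. v x - u x)"
    by (rule add) (use assms in \<open>auto intro!: continuous_intros\<close>)
  finally have "I v = I u + I (\<lambda>x. v x - u x)" .
  moreover have "I (\<lambda>x. v x - u x) \<ge> 0"
    by (rule nonneg) (use assms in \<open>auto intro!: continuous_intros\<close>)
  ultimately show ?thesis by linarith
qed

lemma zero: "I (\<lambda>x. 0) = 0"
  using scale[of "\<lambda>_. 0" 0] by simp

lemma const: "0 \<le> c \<Longrightarrow> I (\<lambda>x. c) = c * I (\<lambda>_. 1)"
  using scale[of "\<lambda>_. 1" c] by simp

lemma one_nonneg: "0 \<le> I (\<lambda>_. 1)"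
  by (rule nonneg) auto

lemma sum:
  assumes "\<And>i. i < n \<Longrightarrow> continuous_on K (w i)" "\<And>i x. i < n \<Longrightarrow> x \<in> K \<Longrightarrow> 0 \<le> w i x"
  shows "I (\<lambda>x. \<Sum>i<n. w i x) = (\<Sum>i<(n::nat). I (w i))"
  using assms
proof (induction n)
  case 0
  then show ?case by (simp add: zero)
next
  case (Suc n)
  have "I (\<lambda>x. (\<Sum>i<n. w i x) + w n x) = I (\<lambda>x. \<Sum>i<n. w i x) + I (w n)"
    by (rule add) (use Suc.prems in \<open>auto intro!: continuous_intros sum_nonneg\<close>)
  then show ?case using Suc by simp
qed

text \<open>The test functions of the Riesz--Markov construction, but required only to vanish on K
  outside U rather than to have support in U. The missing gap to the boundary of U is created when
  needed by lowering u by a small d, see \<open>cut\<close>.\<close>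

definition below :: "'a set \<Rightarrow> ('a \<Rightarrow> real) set" where
  "below U = {u. continuous_on K u \<and> (\<forall>x\<in>K. 0 \<le> u x \<and> u x \<le> indicator U x)}"

definition om :: "'a set \<Rightarrow> ennreal" where
  "om U = (SUP u\<in>below U. ennreal (I u))"

definition outer :: "'a set \<Rightarrow> ennreal" where
  "outer A = (INF U\<in>{U. open U \<and> A \<subseteq> U}. om U)"

lemma belowD:
  assumes "u \<in> below U" "x \<in> K"
  shows "0 \<le> u x" "u x \<le> 1" "x \<notin> U \<Longrightarrow> u x = 0" "u x \<le> indicator U x"
proof -
  have *: "0 \<le> u x" "u x \<le> indicator U x" using assms by (auto simp: below_def)
  show "0 \<le> u x" "u x \<le> indicator U x" by fact+
  show "u x \<le> 1" using * by (cases "x \<in> U") auto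
  show "u x = 0" if "x \<notin> U" using * that by simp
qed

lemma below_cont: "u \<in> below U \<Longrightarrow> continuous_on K u"
  by (simp add: below_def)

lemma zero_below: "(\<lambda>_. 0) \<in> below U"
  by (auto simp: below_def)

lemma om_upper: "u \<in> below U \<Longrightarrow> ennreal (I u) \<le> om U"
  unfolding om_def by (rule SUP_upper)

lemma om_least: "(\<And>u. u \<in> below U \<Longrightarrow> ennreal (I u) \<le> c) \<Longrightarrow> om U \<le> c"
  unfolding om_def by (rule SUP_least)

lemma om_mono: "U \<inter> K \<subseteq> V \<Longrightarrow> om U \<le> om V"
  unfolding om_def by (rule SUP_subset_mono) (auto simp: below_def indicator_def split: if_splits)

lemma om_le: "om U \<le> ennreal (I (\<lambda>_. 1))"
proof (rule om_least)
  fix u assume u: "u \<in> below U"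
  have "I u \<le> I (\<lambda>_. 1)"
    using u by (intro mono) (auto dest: belowD below_cont)
  then show "ennreal (I u) \<le> ennreal (I (\<lambda>_. 1))" by (rule ennreal_leI)
qed

lemma om_UNIV: "om UNIV = ennreal (I (\<lambda>_. 1))"
  by (rule antisym[OF om_le om_upper]) (auto simp: below_def)

lemma outer_open: "open U \<Longrightarrow> outer U = om U"
  unfolding outer_def by (rule antisym) (auto intro!: INF_lower INF_greatest om_mono)

lemma outer_mono: "A \<subseteq> B \<Longrightarrow> outer A \<le> outer B"
  unfolding outer_def by (rule INF_superset_mono) auto

lemma outer_le: "outer A \<le> ennreal (I (\<lambda>_. 1))"
  using outer_mono[of A UNIV] by (simp add: outer_open om_UNIV)

lemma om_null: "U \<inter> K = {} \<Longrightarrow> om U = 0"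
proof -
  assume "U \<inter> K = {}"
  have "om U \<le> 0"
  proof (rule om_least)
    fix u assume u: "u \<in> below U"
    with \<open>U \<inter> K = {}\<close> have "I u = I (\<lambda>_. 0)"
      by (intro cong below_cont[OF u]) (auto intro!: belowD(3)[OF u])
    then show "ennreal (I u) \<le> 0" by (simp add: zero)
  qed
  then show ?thesis by simp
qed

text \<open>The truncated function vanishes outside the set where u exceeds d, which is what a
  support condition would provide; the price d * I 1 is arbitrarily small.\<close>

lemma cut:
  assumes "continuous_on K u" "\<And>x. x \<in> K \<Longrightarrow> 0 \<le> u x" "0 \<le> d"
  shows "I u \<le> I (\<lambda>x. max 0 (u x - d)) + d * I (\<lambda>_. 1)"
proof -
  have "I u \<le> I (\<lambda>x. max 0 (u x - d) + d)"
    by (rule mono) (use assms in \<open>auto intro!: continuous_intros\<close>)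
  also have "\<dots> = I (\<lambda>x. max 0 (u x - d)) + I (\<lambda>_. d)"
    by (rule add) (use assms in \<open>auto intro!: continuous_intros\<close>)
  finally show ?thesis using const[OF assms(3)] by simp
qed

lemma ennreal_le_cut:
  assumes "\<And>d::real. 0 < d \<Longrightarrow> a \<le> c + ennreal (d * I (\<lambda>_. 1))"
  shows "a \<le> c"
proof (rule ennreal_le_epsilon)
  fix e :: real assume e: "0 < e"
  \<comment> \<open>The summand 1 keeps the denominator positive when I 1 = 0.\<close>
  define d where "d = e / (I (\<lambda>_. 1) + 1)"
  have "d > 0" "d * I (\<lambda>_. 1) \<le> e"
    using e one_nonneg by (auto simp: d_def field_simps)
  with assms[of d] show "a \<le> c + ennreal e"
    by (meson add_left_mono ennreal_leI order_trans)
qed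

text \<open>Compactness reduces the countable cover to finitely many sets: where u is at least d,
  some function min 1 (n f_i) with i < n equals 1, and elsewhere u is below d. So u is at most d
  plus a finite sum of test functions for the U i.\<close>

lemma om_countably_subadditive:
  assumes U: "\<And>i::nat. open (U i)"
  shows "om (\<Union>i. U i) \<le> (\<Sum>i. om (U i))"
proof (rule om_least, rule ennreal_le_cut)
  fix u and d :: real assume u: "u \<in> below (\<Union>i. U i)" and d: "0 < d"
  have "\<exists>f :: 'a \<Rightarrow> real. continuous_on UNIV f \<and> (\<forall>x. 0 \<le> f x) \<and> (\<forall>x. 0 < f x \<longleftrightarrow> x \<in> U i)" for i
    using open_eq_pos_continuous[OF U[of i]] by metis
  then obtain f :: "nat \<Rightarrow> 'a \<Rightarrow> real" where f: "\<And>i. continuous_on UNIV (f i)"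
      "\<And>i x. 0 \<le> f i x" "\<And>i x. 0 < f i x \<longleftrightarrow> x \<in> U i"
    by metis
  define F where "F = {x \<in> K. d \<le> u x}"
  have "compact F"
  proof -
    have "closed (K \<inter> u -` {d..})"
      using u compact_K by (intro continuous_closed_preimage) (auto simp: below_def compact_imp_closed)
    moreover have "K \<inter> u -` {d..} = F" by (auto simp: F_def)
    ultimately show ?thesis using compact_K by (metis Int_lower1 compact_Int_closed inf.absorb_iff2)
  qed
  \<comment> \<open>The number of sets and the steepness grow with the same n, so these open sets
    increase and a finite subcover amounts to a single n.\<close>
  define O' where "O' n = (\<Union>i<n. {x. 1 < real n * f i x})" for n
  have opn: "open (O' n)" for n
    unfolding O'_def
    by (intro open_UN ballI open_Collect_less continuous_intros f)
  have inc: "O' m \<subseteq> O' n" if "m \<le> n" for m n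
  proof
    fix x assume "x \<in> O' m"
    then obtain i where i: "i < m" "1 < real m * f i x" by (auto simp: O'_def)
    have "real m * f i x \<le> real n * f i x" using that f(2) by (intro mult_right_mono) auto
    with i that have "i < n" "1 < real n * f i x" by linarith+
    then show "x \<in> O' n" by (auto simp: O'_def)
  qed
  have "F \<subseteq> (\<Union>n. O' n)"
  proof
    fix x assume x: "x \<in> F"
    then have "x \<in> (\<Union>i. U i)"
      using belowD(3)[OF u, of x] d by (auto simp: F_def)
    then obtain i where "0 < f i x" using f by auto
    then obtain n where n: "1 < real n * f i x" using reals_Archimedean3 by blast
    have "real n * f i x \<le> real (max n (Suc i)) * f i x"
      using f(2) by (intro mult_right_mono) auto
    with n have "x \<in> O' (max n (Suc i))" by (auto simp: O'_def intro!: bexI[of _ i])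
    then show "x \<in> (\<Union>n. O' n)" by blast
  qed
  then obtain C where C: "finite C" "F \<subseteq> (\<Union>n\<in>C. O' n)"
    using compactE_image[OF \<open>compact F\<close>, of UNIV O'] opn by auto
  define n where "n = Max (insert 0 C)"
  have "m \<le> n" if "m \<in> C" for m
    unfolding n_def using C(1) that by (intro Max_ge) auto
  then have n: "F \<subseteq> O' n" using C(2) inc by blast
  define w where "w i x = min 1 (real n * f i x)" for i x
  have wb: "w i \<in> below (U i)" for i
    unfolding below_def
  proof (intro CollectI conjI ballI)
    show "continuous_on K (w i)"
      unfolding w_def by (intro continuous_intros continuous_on_subset[OF f(1)]) auto
    fix x
    show "0 \<le> w i x" using f(2)[of i x] by (simp add: w_def)
    have "f i x = 0" if "x \<notin> U i" using f(2)[of i x] f(3)[of i x] that by linarith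
    then show "w i x \<le> indicator (U i) x" by (simp add: w_def indicator_def)
  qed
  have "I u \<le> I (\<lambda>x. (\<Sum>i<n. w i x) + d)"
  proof (rule mono)
    show "continuous_on K u" "\<And>x. x \<in> K \<Longrightarrow> 0 \<le> u x" using u by (auto simp: below_def)
    show "continuous_on K (\<lambda>x. (\<Sum>i<n. w i x) + d)"
      using wb by (auto intro!: continuous_intros simp: below_def)
    fix x assume x: "x \<in> K"
    have w0: "0 \<le> w i x" for i using wb x by (auto simp: below_def)
    show "u x \<le> (\<Sum>i<n. w i x) + d"
    proof (cases "x \<in> F")
      case True
      then obtain i where i: "i < n" "1 < real n * f i x" using n by (auto simp: O'_def)
      have "1 \<le> w i x" using i by (auto simp: w_def)
      also have "\<dots> \<le> (\<Sum>i<n. w i x)" using i w0 by (intro member_le_sum) auto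
      finally have "1 \<le> (\<Sum>i<n. w i x)" .
      moreover have "u x \<le> 1" using belowD[OF u x] by simp
      ultimately show ?thesis using d by simp
    next
      case False
      moreover have "0 \<le> (\<Sum>i<n. w i x)" using w0 by (intro sum_nonneg) auto
      ultimately show ?thesis using x by (auto simp: F_def)
    qed
  qed
  also have "\<dots> = I (\<lambda>x. (\<Sum>i<n. w i x)) + I (\<lambda>_. d)"
    using wb d by (intro add) (auto intro!: continuous_intros sum_nonneg simp: below_def)
  also have "\<dots> = (\<Sum>i<n. I (w i)) + d * I (\<lambda>_. 1)"
    using wb const[of d] d by (subst sum) (auto simp: below_def)
  finally have "ennreal (I u) \<le> ennreal (\<dots>)" by (rule ennreal_leI)
  also have "\<dots> = (\<Sum>i<n. ennreal (I (w i))) + ennreal (d * I (\<lambda>_. 1))"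
  proof -
    have "0 \<le> I (w i)" for i
      by (intro nonneg) (use wb in \<open>auto dest: belowD below_cont\<close>)
    then show ?thesis using d one_nonneg by (simp add: sum_nonneg sum_ennreal)
  qed
  also have "(\<Sum>i<n. ennreal (I (w i))) \<le> (\<Sum>i<n. om (U i))"
    by (intro sum_mono om_upper wb)
  also have "\<dots> \<le> (\<Sum>i. om (U i))"
    by (rule sum_le_suminf) auto
  finally show "ennreal (I u) \<le> (\<Sum>i. om (U i)) + ennreal (d * I (\<lambda>_. 1))"
    by (simp add: add_right_mono)
qed

lemma outer_measure_space_outer: "outer_measure_space (Pow UNIV) outer"
  unfolding outer_measure_space_def
proof (intro conjI)
  show "positive (Pow UNIV) outer"
    by (simp add: positive_def outer_open om_null)
  show "increasing (Pow UNIV) outer"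
    by (simp add: increasing_def outer_mono)
  show "countably_subadditive (Pow UNIV) outer"
    unfolding countably_subadditive_def
  proof (intro allI impI)
    fix A :: "nat \<Rightarrow> 'a set"
    show "outer (\<Union>i. A i) \<le> (\<Sum>i. outer (A i))"
    proof (rule ennreal_le_epsilon)
      fix e :: real assume e: "0 < e"
      have "\<exists>U. open U \<and> A n \<subseteq> U \<and> om U \<le> outer (A n) + ennreal (e * (1/2)^Suc n)" for n
      proof -
        have "outer (A n) < top"
          using outer_le[of "A n"] by (simp add: order_le_less_trans)
        then have "outer (A n) < outer (A n) + ennreal (e * (1/2)^Suc n)"
          using e by (simp add: ennreal_add_left_cancel_less less_top)
        then obtain U where "open U" "A n \<subseteq> U" "om U < outer (A n) + ennreal (e * (1/2)^Suc n)"
          unfolding outer_def[of "A n"] INF_less_iff by auto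
        then show ?thesis by (auto intro: less_imp_le)
      qed
      then obtain U where U: "\<And>n. open (U n)" "\<And>n. A n \<subseteq> U n"
        "\<And>n. om (U n) \<le> outer (A n) + ennreal (e * (1/2)^Suc n)"
        by metis
      have "outer (\<Union>i. A i) \<le> outer (\<Union>i. U i)" using U(2) by (intro outer_mono UN_mono) auto
      also have "\<dots> = om (\<Union>i. U i)" using U(1) by (intro outer_open) auto
      also have "\<dots> \<le> (\<Sum>n. om (U n))" by (rule om_countably_subadditive[OF U(1)])
      also have "\<dots> \<le> (\<Sum>n. outer (A n) + ennreal (e * (1/2) ^ Suc n))"
        using U(3) by (intro suminf_le) auto
      also have "\<dots> = (\<Sum>n. outer (A n)) + (\<Sum>n. ennreal e * ennreal ((1/2) ^ Suc n))"
        using \<open>0 < e\<close> by (subst suminf_add[symmetric])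
                       (auto simp del: ennreal_suminf_cmult simp add: ennreal_mult[symmetric])
      also have "\<dots> = (\<Sum>n. outer (A n)) + e"
        unfolding ennreal_suminf_cmult
        by (subst suminf_ennreal_eq[OF zero_le_power power_half_series]) auto
      finally show "outer (\<Union>i. A i) \<le> (\<Sum>n. outer (A n)) + ennreal e" .
    qed
  qed
qed

lemma outer_Un: "outer (A \<union> B) \<le> outer A + outer B"
proof -
  have "subadditive (Pow UNIV) outer"
    using outer_measure_space_outer
    by (intro ring_of_sets.countably_subadditive_subadditive[of UNIV])
      (simp_all add: outer_measure_space_def ring_of_sets_iff)
  have "outer (A \<union> (B - A)) \<le> outer A + outer (B - A)"
    using subadditiveD[OF \<open>subadditive _ _\<close>, of A "B - A"] by auto
  also have "\<dots> \<le> outer A + outer B" by (intro add_left_mono outer_mono) auto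
  finally show ?thesis by simp
qed

text \<open>For open V, a test function u of U \<inter> V lowered by d lives on the closed set F
  \<subseteq> U where u is at least d. Any test function of V - F can be added to it and the sum is
  still a test function of V; moreover V - U \<subseteq> V - F. A general set A is approximated by
  open V from outside.\<close>

lemma open_caratheodory:
  assumes U: "open U"
  shows "outer (U \<inter> A) + outer (A - U) \<le> outer A"
proof -
  have main: "outer (U \<inter> V) + outer (V - U) \<le> om V" if V: "open V" for V
  proof -
    have "ennreal (I u) + outer (V - U) \<le> om V" if u: "u \<in> below (U \<inter> V)" for u
    proof (rule ennreal_le_cut)
      fix d :: real assume d: "0 < d"
      have uc: "continuous_on K u" and u0: "\<And>x. x \<in> K \<Longrightarrow> 0 \<le> u x"
        using u by (auto simp: below_def)
      define F where "F = K \<inter> u -` {d..}"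
      have "closed F"
        unfolding F_def using uc compact_K 
        by (intro continuous_closed_preimage) (auto simp: compact_imp_closed)
      then have opn: "open (V - F)" using V by auto
      have "F \<subseteq> U"
        using belowD(3)[OF u] d by (fastforce simp: F_def)
      let ?u = "\<lambda>x. max 0 (u x - d)"
      have u': "continuous_on K ?u" "\<And>x. x \<in> K \<Longrightarrow> 0 \<le> ?u x"
        using uc by (auto intro!: continuous_intros)
      have "ennreal (I ?u) + om (V - F) \<le> om V"
        unfolding om_def[of "V - F"]
      proof (subst ennreal_SUP_add_right)
        show "below (V - F) \<noteq> {}" using zero_below by blast
        show "(SUP v\<in>below (V - F). ennreal (I ?u) + ennreal (I v)) \<le> om V"
        proof (rule SUP_least)
          fix v assume v: "v \<in> below (V - F)"
          have v': "continuous_on K v" "\<And>x. x \<in> K \<Longrightarrow> 0 \<le> v x" using v by (auto simp: below_def)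
          have "(\<lambda>x. ?u x + v x) \<in> below V"
            unfolding below_def
          proof (intro CollectI conjI ballI)
            show "continuous_on K (\<lambda>x. ?u x + v x)" by (intro continuous_on_add u' v')
            fix x assume x: "x \<in> K"
            show "0 \<le> ?u x + v x" using u'(2)[OF x] v'(2)[OF x] by simp
            show "?u x + v x \<le> indicator V x"
            proof (cases "x \<in> F")
              case True
              then have "v x \<le> 0" using v x by (auto simp: below_def)
              moreover have "u x \<le> indicator V x"
                using belowD[OF u x] by (auto simp: indicator_def split: if_splits)
              ultimately show ?thesis using d by (auto simp: indicator_def)
            next
              case False
              then have "?u x = 0" using x by (auto simp: F_def)
              moreover have "v x \<le> indicator V x"
                using belowD[OF v x] by (auto simp: indicator_def split: if_splits)
              ultimately show ?thesis by simp
            qed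
          qed
          then have "ennreal (I (\<lambda>x. ?u x + v x)) \<le> om V" by (rule om_upper)
          then show "ennreal (I ?u) + ennreal (I v) \<le> om V"
            by (simp add: add[OF u' v'] nonneg[OF u'] nonneg[OF v'])
        qed
      qed
      moreover have "outer (V - U) \<le> om (V - F)"
        using outer_mono[of "V - U" "V - F"] \<open>F \<subseteq> U\<close> outer_open[OF opn] by auto
      moreover have "ennreal (I u) \<le> ennreal (I ?u) + ennreal (d * I (\<lambda>_. 1))"
        using cut[OF uc u0, of d] d one_nonneg nonneg[OF u'] by (simp flip: ennreal_plus add: ennreal_leI)
      ultimately have "ennreal (I u) + outer (V - U)
          \<le> (ennreal (I ?u) + ennreal (d * I (\<lambda>_. 1))) + om (V - F)"
        by (intro add_mono)
      also have "\<dots> = (ennreal (I ?u) + om (V - F)) + ennreal (d * I (\<lambda>_. 1))"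
        by (simp add: ac_simps)
      also have "\<dots> \<le> om V + ennreal (d * I (\<lambda>_. 1))"
        by (intro add_right_mono) fact
      finally show "ennreal (I u) + outer (V - U) \<le> om V + ennreal (d * I (\<lambda>_. 1))" .
    qed
    then have "(SUP u\<in>below (U \<inter> V). ennreal (I u) + outer (V - U)) \<le> om V"
      by (intro SUP_least)
    moreover have "below (U \<inter> V) \<noteq> {}" using zero_below by blast
    ultimately have "om (U \<inter> V) + outer (V - U) \<le> om V"
      unfolding om_def[of "U \<inter> V"] by (simp add: ennreal_SUP_add_left)
    then show ?thesis using U V by (simp add: outer_open open_Int)
  qed
  show ?thesis
    unfolding outer_def[of A]
  proof (rule INF_greatest)
    fix V assume V: "V \<in> {V. open V \<and> A \<subseteq> V}"
    have "outer (U \<inter> A) + outer (A - U) \<le> outer (U \<inter> V) + outer (V - U)"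
      using V by (intro add_mono outer_mono) auto
    also have "\<dots> \<le> om V" using main V by auto
    finally show "outer (U \<inter> A) + outer (A - U) \<le> om V" .
  qed
qed

text \<open>Taken on the whole space, since \<open>outer\<close> works with open subsets of the
  space; K enters through \<open>below\<close> only, and the restriction to K follows.\<close>

definition N\<^sub>0 :: "'a measure" where
  "N\<^sub>0 = measure_of UNIV (sets borel) outer"

lemma sets_N\<^sub>0 [simp, measurable_cong]: "sets N\<^sub>0 = sets borel"
  unfolding N\<^sub>0_def using sets.sigma_sets_eq[of borel] by simp

lemma space_N\<^sub>0 [simp]: "space N\<^sub>0 = UNIV"
  unfolding N\<^sub>0_def by simp

text \<open>By Caratheodory's lemma \<open>outer\<close> is a measure on its
  \<open>lambda_system\<close>, a sigma-algebra that contains the open sets by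
  \<open>open_caratheodory\<close> and hence all Borel sets. Without this, \<open>measure_of\<close>
  could be the zero measure.\<close>

lemma emeasure_N\<^sub>0: "A \<in> sets borel \<Longrightarrow> emeasure N\<^sub>0 A = outer A"
proof -
  assume A: "A \<in> sets borel"
  let ?L = "lambda_system UNIV (Pow UNIV) outer"
  have ms: "measure_space UNIV ?L outer"
    using sigma_algebra.caratheodory_lemma[OF sigma_algebra_Pow outer_measure_space_outer] .
  have "U \<in> ?L" if "open U" for U
    unfolding lambda_system_def
  proof (intro CollectI conjI ballI)
    fix A :: "'a set"
    have "outer ((U \<inter> A) \<union> (A - U)) \<le> outer (U \<inter> A) + outer (A - U)" by (rule outer_Un)
    moreover have "(U \<inter> A) \<union> (A - U) = A" "(UNIV - U) \<inter> A = A - U" by auto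
    ultimately show "outer (U \<inter> A) + outer ((UNIV - U) \<inter> A) = outer A"
      using open_caratheodory[OF that, of A] by (auto intro: antisym)
  qed auto
  then have "sigma_sets UNIV {U. open U} \<subseteq> ?L"
    using ms by (intro sigma_algebra.sigma_sets_subset) (auto simp: measure_space_def)
  then have sub: "sets borel \<subseteq> ?L" by (simp add: borel_def)
  show ?thesis
    unfolding N\<^sub>0_def
  proof (rule emeasure_measure_of_sigma[OF _ _ _ A])
    show "sigma_algebra UNIV (sets (borel :: 'a measure))"
      using sets.sigma_algebra_axioms[of "borel :: 'a measure"] by simp
    show "positive (sets borel) outer"
      by (simp add: positive_def outer_open om_null)
    show "countably_additive (sets borel) outer"
      using ms sub by (auto simp: measure_space_def countably_additive_def)
  qed
qed

section \<open>The representing measure on K\<close>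

definition N where "N = restrict_space N\<^sub>0 K"

lemma sets_N: "sets N = borel_subsets K"
  by (simp add: N_def sets_restrict_space)

lemma space_N: "space N = K"
  by (simp add: N_def space_restrict_space)

text \<open>Nothing is lost by restricting to K: as K is closed, U - K is open, and an open set that
  misses K has no test functions but those vanishing on K.\<close>

lemma emeasure_N_open:
  assumes "open U"
  shows "emeasure N (U \<inter> K) = om U"
proof -
  have [measurable]: "U \<in> sets borel" "K \<in> sets borel" using assms compact_K by (auto simp: borel_compact)
  have "emeasure N (U \<inter> K) = emeasure N\<^sub>0 (U \<inter> K)"
    unfolding N_def by (rule emeasure_restrict_space) auto
  moreover have "emeasure N\<^sub>0 (U \<inter> K) + emeasure N\<^sub>0 (U - K) = emeasure N\<^sub>0 ((U \<inter> K) \<union> (U - K))"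
    by (rule plus_emeasure) auto
  then have "emeasure N\<^sub>0 (U \<inter> K) + outer (U - K) = outer U"
    by (simp add: emeasure_N\<^sub>0 Un_Diff_Int Int_Diff_Un)
  moreover have "open (U - K)" using assms compact_K by (simp add: compact_imp_closed open_Diff)
  then have "outer (U - K) = 0" using om_null[of "U - K"] by (auto simp: outer_open)
  ultimately show ?thesis using assms by (simp add: outer_open)
qed

lemma emeasure_N_space: "emeasure N K = ennreal (I (\<lambda>_. 1))"
  using emeasure_N_open[of UNIV] by (simp add: om_UNIV)

sublocale N: finite_measure N
  by standard (simp add: space_N emeasure_N_space)

lemma integrable_N:
  fixes u :: "'a \<Rightarrow> 'b::{banach, second_countable_topology}"
  assumes "continuous_on K u"
  shows "integrable N u"
  by (rule integrable_continuous_compact[OF compact_K assms sets_N]) (simp add: emeasure_N_space)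

text \<open>The layer of u between t and t + d, divided by d, is a test function for an open set
  whose trace on K is the superlevel set.\<close>

lemma slice:
  assumes u: "continuous_on K u" and d: "0 < d"
  shows "I (\<lambda>x. max 0 (min (u x - t) d)) \<le> d * measure N {x \<in> K. t < u x}"
proof -
  obtain V where V: "open V" "V \<inter> K = {x \<in> K. t < u x}"
  proof -
    have "openin (top_of_set K) (K \<inter> u -` {t<..})"
      by (rule continuous_openin_preimage_gen[OF u open_greaterThan])
    then obtain V where V: "open V" "K \<inter> u -` {t<..} = K \<inter> V"
      unfolding openin_open by blast
    have "V \<inter> K = K \<inter> u -` {t<..}" using V by blast
    also have "\<dots> = {x \<in> K. t < u x}" by auto
    finally show ?thesis using V by (intro that)
  qed
  let ?w = "\<lambda>x. (1/d) * max 0 (min (u x - t) d)"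
  have c: "continuous_on K (\<lambda>x. max 0 (min (u x - t) d))"
    using u by (intro continuous_intros)
  have "?w \<in> below V"
    unfolding below_def
  proof (intro CollectI conjI ballI)
    show "continuous_on K ?w" by (intro continuous_intros u)
    fix x assume x: "x \<in> K"
    show "0 \<le> ?w x" using d by auto
    show "?w x \<le> indicator V x"
    proof (cases "x \<in> V")
      case True then show ?thesis using d by (auto simp: field_simps)
    next
      case False
      then have "u x \<le> t" using V x by force
      then show ?thesis using d by (auto simp: field_simps)
    qed
  qed
  then have "ennreal (I ?w) \<le> emeasure N (V \<inter> K)"
    unfolding emeasure_N_open[OF V(1)] by (rule om_upper)
  then have "I ?w \<le> measure N {x \<in> K. t < u x}"
    unfolding V(2) N.emeasure_eq_measure by simp
  moreover have "I ?w = (1/d) * I (\<lambda>x. max 0 (min (u x - t) d))"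
    using d by (intro scale[OF c]) auto
  moreover have "d * I ?w \<le> d * measure N {x \<in> K. t < u x}"
    using calculation d by (intro mult_left_mono) auto
  ultimately show ?thesis using d by simp
qed

text \<open>The layers of height \<open>d\<close> of \<open>u\<close> are compared with the superlevel sets of \<open>u\<close>, from below by
  the measure and from above by \<open>I\<close>; the comparison shifts by one layer.\<close>

lemma le_integral:
  assumes u: "continuous_on K u" and u0: "\<And>x. x \<in> K \<Longrightarrow> 0 \<le> u x"
  shows "I u \<le> integral\<^sup>L N u"
proof -
  have step: "I u \<le> d * I (\<lambda>_. 1) + integral\<^sup>L N u" if d: "0 < d" for d
  proof -
    have cont: "continuous_on K (\<lambda>x. min (u x) c)" for c using u by (intro continuous_intros)
    have ind: "I (\<lambda>x. min (u x) (real (Suc k) * d))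
      \<le> d * I (\<lambda>_. 1) + integral\<^sup>L N (\<lambda>x. min (u x) (real k * d))" for k
    proof (induction k)
      case 0
      have "I (\<lambda>x. min (u x) d) \<le> I (\<lambda>_. d)"
        using d by (intro mono cont) (auto simp: u0)
      moreover have "integral\<^sup>L N (\<lambda>x. min (u x) 0) = integral\<^sup>L N (\<lambda>_. 0)"
        by (rule Bochner_Integration.integral_cong) (auto simp: space_N u0)
      ultimately show ?case using const[of d] d by simp
    next
      case (Suc k)
      define a b c where "a = real k * d" and "b = real (Suc k) * d" and "c = real (Suc (Suc k)) * d"
      have abc: "0 \<le> a" "b = a + d" "c = b + d"
        using d by (auto simp: a_def b_def c_def algebra_simps)
      have "I (\<lambda>x. min (u x) c) = I (\<lambda>x. min (u x) b + max 0 (min (u x - b) d))"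
        by (intro cong cont) (use d abc in auto)
      also have "\<dots> = I (\<lambda>x. min (u x) b) + I (\<lambda>x. max 0 (min (u x - b) d))"
        using u0 d abc by (intro add cont) (auto intro!: continuous_intros u)
      also have "I (\<lambda>x. max 0 (min (u x - b) d)) \<le> d * measure N {x \<in> K. b < u x}"
        by (rule slice[OF u d])
      also have "\<dots> = integral\<^sup>L N (\<lambda>x. d * indicator {x \<in> K. b < u x} x)"
        by (simp add: space_N Int_absorb2)
      \<comment> \<open>Wherever u exceeds b, the layer between a and b = a + d has its full height
        d. This is the shift by one layer, and it costs the bottom layer d * I 1 once.\<close>
      also have "\<dots> \<le> integral\<^sup>L N (\<lambda>x. min (u x) b - min (u x) a)"
      proof (rule integral_mono')
        show "integrable N (\<lambda>x. min (u x) b - min (u x) a)"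
          by (intro integrable_N continuous_intros u)
        fix x assume "x \<in> space N"
        show "d * indicator {x \<in> K. b < u x} x \<le> min (u x) b - min (u x) a"
          using d abc by (auto simp: indicator_def min_def)
        show "0 \<le> min (u x) b - min (u x) a"
          using d abc by (auto simp: min_def)
      qed
      also have "\<dots> = integral\<^sup>L N (\<lambda>x. min (u x) b) - integral\<^sup>L N (\<lambda>x. min (u x) a)"
        by (intro Bochner_Integration.integral_diff integrable_N cont)
      finally show ?case using Suc.IH unfolding a_def[symmetric] b_def[symmetric] c_def[symmetric] by linarith
    qed
    have "bounded (u ` K)" using u compact_K by (simp add: compact_continuous_image compact_imp_bounded)
    then obtain b where "\<forall>x\<in>K. \<bar>u x\<bar> \<le> b" by (auto simp: bounded_iff)
    then have b: "\<And>x. x \<in> K \<Longrightarrow> u x \<le> b" by (auto simp: abs_le_iff)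
    obtain k where "b < real k * d" using reals_Archimedean3[OF d] by blast
    then have ub: "u x \<le> real k * d" if "x \<in> K" for x using b[OF that] by simp
    have ub': "u x \<le> real (Suc k) * d" if "x \<in> K" for x
      using ub[OF that] d by (simp add: algebra_simps)
    have "I u = I (\<lambda>x. min (u x) (real (Suc k) * d))"
      by (intro cong u) (use ub' in \<open>auto simp: min_def\<close>)
    also note ind[of k]
    also have "integral\<^sup>L N (\<lambda>x. min (u x) (real k * d)) = integral\<^sup>L N u"
      by (rule Bochner_Integration.integral_cong) (use ub in \<open>auto simp: space_N min_def\<close>)
    finally show ?thesis by simp
  qed
  show ?thesis
  proof (rule field_le_epsilon)
    fix e :: real assume e: "0 < e"
    have "I u \<le> e / (I (\<lambda>_. 1) + 1) * I (\<lambda>_. 1) + integral\<^sup>L N u"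
      using e one_nonneg by (intro step) auto
    also have "e / (I (\<lambda>_. 1) + 1) * I (\<lambda>_. 1) \<le> e"
      using e one_nonneg by (auto simp: field_simps)
    finally show "I u \<le> integral\<^sup>L N u + e" by simp
  qed
qed

text \<open>The reverse inequality is \<open>le_integral\<close> for b - u, with b an upper bound of
  u, because constants are integrated exactly.\<close>

lemma eq_integral:
  assumes u: "continuous_on K u" and u0: "\<And>x. x \<in> K \<Longrightarrow> 0 \<le> u x"
  shows "I u = integral\<^sup>L N u"
proof -
  have "bounded (u ` K)" using u compact_K by (simp add: compact_continuous_image compact_imp_bounded)
  then obtain b where "0 < b" "\<forall>x\<in>K. \<bar>u x\<bar> \<le> b" by (auto simp: bounded_pos)
  then have b: "0 < b" "\<And>x. x \<in> K \<Longrightarrow> u x \<le> b" by (auto simp: abs_le_iff)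
  have c: "continuous_on K (\<lambda>x. b - u x)" using u by (intro continuous_intros)
  have "I (\<lambda>x. b - u x) \<le> integral\<^sup>L N (\<lambda>x. b - u x)"
    by (intro le_integral c) (use b in auto)
  also have "\<dots> = b * I (\<lambda>_. 1) - integral\<^sup>L N u"
    using emeasure_N_space one_nonneg
    by (subst Bochner_Integration.integral_diff)
      (auto simp: integrable_N u space_N measure_def)
  finally have "I (\<lambda>x. b - u x) \<le> b * I (\<lambda>_. 1) - integral\<^sup>L N u" .
  moreover have "I (\<lambda>x. u x + (b - u x)) = I u + I (\<lambda>x. b - u x)"
    by (intro add u c u0) (use b in auto)
  then have "I u + I (\<lambda>x. b - u x) = b * I (\<lambda>_. 1)"
    using const[of b] b by simp
  ultimately show ?thesis using le_integral[OF u u0] by simp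
qed

end

text \<open>The positive part of a bounded functional \<open>J\<close> sends \<open>u \<ge> 0\<close> to the supremum of
  \<open>J v\<close> over \<open>0 \<le> v \<le> u\<close>. Both it and its difference with \<open>J\<close> are represented by measures.\<close>

lemma riesz_representation_real:
  fixes K :: "'a::metric_space set" and J :: "('a \<Rightarrow> real) \<Rightarrow> real"
  assumes K: "compact K" and c: "0 \<le> c"
    and add: "\<And>u v. continuous_on K u \<Longrightarrow> continuous_on K v \<Longrightarrow> J (\<lambda>x. u x + v x) = J u + J v"
    and scale: "\<And>u r. continuous_on K u \<Longrightarrow> J (\<lambda>x. r * u x) = r * J u"
    and bound: "\<And>u b. continuous_on K u \<Longrightarrow> 0 \<le> b \<Longrightarrow> (\<And>x. x \<in> K \<Longrightarrow> \<bar>u x\<bar> \<le> b) \<Longrightarrow> \<bar>J u\<bar> \<le> c * b"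
  obtains P N where "sets P = borel_subsets K" "sets N = borel_subsets K"
    "emeasure P K \<le> ennreal c" "emeasure N K \<le> ennreal (2 * c)"
    "\<And>u. continuous_on K u \<Longrightarrow> integrable P u \<and> integrable N u \<and> J u = integral\<^sup>L P u - integral\<^sup>L N u"
proof -
  have J0: "J (\<lambda>_. 0) = 0" using scale[of "\<lambda>_. 0" 0] by simp
  have diff: "J (\<lambda>x. u x - v x) = J u - J v" if "continuous_on K u" "continuous_on K v" for u v
  proof -
    have "J (\<lambda>x. u x + (-1) * v x) = J u + J (\<lambda>x. (-1) * v x)"
      by (intro add continuous_intros that)
    also have "J (\<lambda>x. (-1) * v x) = - J v" using scale[OF that(2), of "-1"] by simp
    finally show ?thesis by simp
  qed
  have J_cong: "J u = J v" if u: "continuous_on K u" and eq: "\<And>x. x \<in> K \<Longrightarrow> u x = v x" for u v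
  proof -
    have v: "continuous_on K v" using u eq by (simp cong: continuous_on_cong)
    have "\<bar>J (\<lambda>x. u x - v x)\<bar> \<le> c * 0"
      by (intro bound continuous_intros u v) (use eq in auto)
    then show ?thesis using diff[OF u v] by simp
  qed
  define D where "D u = {v. continuous_on K v \<and> (\<forall>x\<in>K. 0 \<le> v x \<and> v x \<le> u x)}" for u :: "'a \<Rightarrow> real"
  define P where "P u = (SUP v\<in>D u. J v)" for u
  have D_ne: "(\<lambda>_. 0) \<in> D u" if "\<And>x. x \<in> K \<Longrightarrow> 0 \<le> u x" for u
    using that by (auto simp: D_def)
  have JD: "\<bar>J v\<bar> \<le> c * b" if "v \<in> D u" "\<And>x. x \<in> K \<Longrightarrow> u x \<le> b" "0 \<le> b" for v u b
    using that by (intro bound) (auto simp: D_def intro: order_trans)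
  have bdd: "bdd_above (J ` D u)" if u: "continuous_on K u" for u
  proof -
    have "bounded (u ` K)" using u K by (simp add: compact_continuous_image compact_imp_bounded)
    then obtain b where b: "0 < b" "\<forall>x\<in>K. \<bar>u x\<bar> \<le> b" by (auto simp: bounded_pos)
    show ?thesis
      by (rule bdd_aboveI2[of _ _ "c * b"]) (use JD[of _ u b] b in \<open>fastforce simp: abs_le_iff\<close>)
  qed
  have P_upper: "J v \<le> P u" if "continuous_on K u" "v \<in> D u" for u v
    unfolding P_def by (rule cSUP_upper[OF that(2) bdd[OF that(1)]])
  have P_least: "P u \<le> a" if "\<And>x. x \<in> K \<Longrightarrow> 0 \<le> u x" "\<And>v. v \<in> D u \<Longrightarrow> J v \<le> a" for u a
    unfolding P_def by (rule cSUP_least) (use that D_ne in auto)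
  have P_cong: "P u = P v" if "\<And>x. x \<in> K \<Longrightarrow> u x = v x" for u v
  proof -
    have "D u = D v" using that by (auto simp: D_def)
    then show ?thesis by (simp add: P_def)
  qed
  have P_add: "P (\<lambda>x. u x + v x) = P u + P v"
    if u: "continuous_on K u" "\<And>x. x \<in> K \<Longrightarrow> 0 \<le> u x" 
      and v: "continuous_on K v" "\<And>x. x \<in> K \<Longrightarrow> 0 \<le> v x" for u v
  proof (rule antisym)
    show "P (\<lambda>x. u x + v x) \<le> P u + P v"
    proof (rule P_least)
      fix x assume "x \<in> K" then show "0 \<le> u x + v x" using u v by simp
    next
      fix w assume w: "w \<in> D (\<lambda>x. u x + v x)"
      \<comment> \<open>Riesz decomposition: a function between 0 and u + v is the sum of one
        between 0 and u and one between 0 and v.\<close>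
      let ?w = "\<lambda>x. min (w x) (u x)"
      have wc: "continuous_on K w" using w by (simp add: D_def)
      have w1: "?w \<in> D u" using w u wc by (auto simp: D_def intro!: continuous_intros)
      have w2: "(\<lambda>x. w x - ?w x) \<in> D v"
        unfolding D_def
      proof (intro CollectI conjI ballI)
        show "continuous_on K (\<lambda>x. w x - ?w x)" by (intro continuous_intros wc u)
        fix x assume "x \<in> K"
        then have "w x \<le> u x + v x" "0 \<le> v x" using w v by (auto simp: D_def)
        then show "0 \<le> w x - ?w x" "w x - ?w x \<le> v x" by auto
      qed
      have "J (\<lambda>x. w x - ?w x) = J w - J ?w"
        by (intro diff wc continuous_intros u)
      then show "J w \<le> P u + P v"
        using P_upper[OF u(1) w1] P_upper[OF v(1) w2] by simp
    qed
    have JP: "J w1 + J w2 \<le> P (\<lambda>x. u x + v x)" if w: "w1 \<in> D u" "w2 \<in> D v" for w1 w2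
    proof -
      have "(\<lambda>x. w1 x + w2 x) \<in> D (\<lambda>x. u x + v x)"
        using w by (auto simp: D_def intro!: continuous_intros add_mono)
      then have "J (\<lambda>x. w1 x + w2 x) \<le> P (\<lambda>x. u x + v x)"
        by (intro P_upper continuous_intros u v)
      then show ?thesis using w add by (simp add: D_def)
    qed
    have "P v \<le> P (\<lambda>x. u x + v x) - J w1" if w1: "w1 \<in> D u" for w1
    proof (rule P_least[OF v(2)])
      show "J w2 \<le> P (\<lambda>x. u x + v x) - J w1" if "w2 \<in> D v" for w2
        using JP[OF w1 that] by simp
    qed
    then have "P u \<le> P (\<lambda>x. u x + v x) - P v"
      by (intro P_least u) (auto simp: algebra_simps)
    then show "P u + P v \<le> P (\<lambda>x. u x + v x)" by simp
  qed
  have P_scale_le: "P (\<lambda>x. r * u x) \<le> r * P u"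
    if u: "continuous_on K u" "\<And>x. x \<in> K \<Longrightarrow> 0 \<le> u x" and r: "0 < r" for u r
  proof (rule P_least)
    fix v assume v: "v \<in> D (\<lambda>x. r * u x)"
    then have "(\<lambda>x. inverse r * v x) \<in> D u"
      using r by (auto simp: D_def field_simps intro!: continuous_intros)
    then have "J (\<lambda>x. inverse r * v x) \<le> P u" by (rule P_upper[OF u(1)])
    moreover have "J (\<lambda>x. inverse r * v x) = inverse r * J v"
      using v by (intro scale) (simp add: D_def)
    ultimately have "inverse r * J v \<le> P u" by linarith
    then have "r * (inverse r * J v) \<le> r * P u" using r by (intro mult_left_mono) auto
    moreover have "r * (inverse r * J v) = J v" using r by simp
    ultimately show "J v \<le> r * P u" by linarith
  qed (use u r in auto)
  have P_scale: "P (\<lambda>x. r * u x) = r * P u"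
    if u: "continuous_on K u" "\<And>x. x \<in> K \<Longrightarrow> 0 \<le> u x" and r: "0 \<le> r" for u r
  proof (cases "r = 0")
    case True
    have "P (\<lambda>_. 0) \<le> 0"
    proof (rule P_least)
      fix v assume v: "v \<in> D (\<lambda>_. 0)"
      then have "J v = J (\<lambda>_. 0)" by (intro J_cong) (auto simp: D_def order_class.order_eq_iff)
      then show "J v \<le> 0" using J0 by simp
    qed auto
    moreover have "0 \<le> P (\<lambda>_. 0)" using P_upper[OF _ D_ne, of "\<lambda>_. 0"] J0 by simp
    ultimately show ?thesis using True by simp
  next
    case False
    \<comment> \<open>The other direction is the first one for the factor 1 / r and the function r
      u.\<close>
    have "P (\<lambda>x. inverse r * (r * u x)) \<le> inverse r * P (\<lambda>x. r * u x)"
      by (rule P_scale_le) (use u r False in \<open>auto intro!: continuous_intros\<close>)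
    also have "(\<lambda>x. inverse r * (r * u x)) = u" using False by auto
    finally have "r * P u \<le> r * (inverse r * P (\<lambda>x. r * u x))" using r by (intro mult_left_mono)
    moreover have "r * (inverse r * P (\<lambda>x. r * u x)) = P (\<lambda>x. r * u x)" using False by simp
    ultimately have "r * P u \<le> P (\<lambda>x. r * u x)" by linarith
    moreover have "P (\<lambda>x. r * u x) \<le> r * P u" using P_scale_le u r False by simp
    ultimately show ?thesis by simp
  qed
  have P_nonneg: "0 \<le> P u" if "continuous_on K u" "\<And>x. x \<in> K \<Longrightarrow> 0 \<le> u x" for u
    using P_upper[OF that(1) D_ne] that J0 by simp
  have P_ge: "J u \<le> P u" if "continuous_on K u" "\<And>x. x \<in> K \<Longrightarrow> 0 \<le> u x" for u
    using that by (intro P_upper) (auto simp: D_def)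
  interpret P: cone_functional K P
    by (rule cone_functional.intro) (fact K, fact P_nonneg, fact P_add, fact P_scale, rule P_cong)
  interpret N: cone_functional K "\<lambda>u. P u - J u"
  proof
    show "0 \<le> P u - J u" if "continuous_on K u" "\<And>x. x \<in> K \<Longrightarrow> 0 \<le> u x" for u
      using P_ge[OF that] by simp
    show "P (\<lambda>x. u x + v x) - J (\<lambda>x. u x + v x) = P u - J u + (P v - J v)"
      if "continuous_on K u" "\<And>x. x \<in> K \<Longrightarrow> 0 \<le> u x" "continuous_on K v" "\<And>x. x \<in> K \<Longrightarrow> 0 \<le> v x"
      for u v
      using P_add[OF that] add[OF that(1,3)] by simp
    show "P (\<lambda>x. r * u x) - J (\<lambda>x. r * u x) = r * (P u - J u)"
      if "continuous_on K u" "\<And>x. x \<in> K \<Longrightarrow> 0 \<le> u x" "0 \<le> r" for u r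
      using P_scale[OF that] scale[OF that(1)] by (simp add: right_diff_distrib)
    show "P u - J u = P v - J v" if "continuous_on K u" "\<And>x. x \<in> K \<Longrightarrow> u x = v x" for u v
      using P_cong[OF that(2)] J_cong[OF that] by simp
  qed (rule K)
  have J1: "\<bar>J (\<lambda>_. 1)\<bar> \<le> c" using bound[of "\<lambda>_. 1" 1] by simp
  have P1: "P (\<lambda>_. 1) \<le> c"
  proof (rule P_least)
    fix v assume "v \<in> D (\<lambda>_. 1)"
    then show "J v \<le> c" using JD[of v "\<lambda>_. 1" 1] by simp
  qed auto
  have cone: "J u = integral\<^sup>L P.N u - integral\<^sup>L N.N u"
    if "continuous_on K u" "\<And>x. x \<in> K \<Longrightarrow> 0 \<le> u x" for u
    using P.eq_integral[OF that] N.eq_integral[OF that] by simp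
  show ?thesis
  proof (rule that)
    show "sets P.N = borel_subsets K" "sets N.N = borel_subsets K"
      by (rule P.sets_N N.sets_N)+
    show "emeasure P.N K \<le> ennreal c"
      unfolding P.emeasure_N_space using P1 by (rule ennreal_leI)
    \<comment> \<open>The mass is P 1 - J 1, and both P 1 and the absolute value of J 1 are at most
      c.\<close>
    show "emeasure N.N K \<le> ennreal (2 * c)"
      unfolding N.emeasure_N_space using P1 J1 by (intro ennreal_leI) simp
    fix u :: "'a \<Rightarrow> real" assume u: "continuous_on K u"
    let ?p = "\<lambda>x. max 0 (u x)" and ?n = "\<lambda>x. max 0 (- u x)"
    have pn: "continuous_on K ?p" "continuous_on K ?n" using u by (auto intro!: continuous_intros)
    have eq: "(\<lambda>x. ?p x - ?n x) = u" by (auto simp: max_def)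
    have i: "integrable P.N u" "integrable N.N u" using u by (auto intro: P.integrable_N N.integrable_N)
    have "J (\<lambda>x. ?p x - ?n x) = J ?p - J ?n" by (rule diff[OF pn])
    also have "\<dots> = integral\<^sup>L P.N (\<lambda>x. ?p x - ?n x) - integral\<^sup>L N.N (\<lambda>x. ?p x - ?n x)"
      using cone[OF pn(1)] cone[OF pn(2)]
        Bochner_Integration.integral_diff[OF P.integrable_N[OF pn(1)] P.integrable_N[OF pn(2)]]
        Bochner_Integration.integral_diff[OF N.integrable_N[OF pn(1)] N.integrable_N[OF pn(2)]]
      by simp
    finally show "integrable P.N u \<and> integrable N.N u \<and> J u = integral\<^sup>L P.N u - integral\<^sup>L N.N u"
      using i unfolding eq by simp
  qed
qed

section \<open>Integrals against the Jordan parts of a difference of measures\<close>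

text \<open>Equality of the differences A - C and D - B, written with sums because extended
  nonnegative values cannot be subtracted. It passes from indicators to all measurable functions by
  linearity and monotone limits.\<close>

lemma nn_integral_add_measures:
  assumes [simp]: "sets B = sets A" "sets C = sets A" "sets D = sets A"
    and eq: "\<And>X. X \<in> sets A \<Longrightarrow> emeasure A X + emeasure B X = emeasure C X + emeasure D X"
    and f: "f \<in> borel_measurable A"
  shows "integral\<^sup>N A f + integral\<^sup>N B f = integral\<^sup>N C f + integral\<^sup>N D f"
  using f
proof (induction f)
  case (cong f g)
  have [simp]: "space B = space A" "space C = space A" "space D = space A"
    using assms(1-3)[THEN sets_eq_imp_space_eq] by auto
  have "integral\<^sup>N M f = integral\<^sup>N M g" if "M \<in> {A, B, C, D}" for M
    using cong that by (intro nn_integral_cong) auto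
  then show ?case using cong by simp
next
  case (set X)
  then show ?case using eq by simp
next
  case (mult u c)
  have [measurable]: "u \<in> borel_measurable M" if "M \<in> {A, B, C, D}" for M
    using mult that by (auto cong: measurable_cong_sets)
  show ?case using mult by (simp add: nn_integral_cmult flip: distrib_left)
next
  case (add u v)
  have [measurable]: "u \<in> borel_measurable M" "v \<in> borel_measurable M" if "M \<in> {A, B, C, D}" for M
    using add that by (auto cong: measurable_cong_sets)
  have "integral\<^sup>N M (\<lambda>x. v x + u x) = integral\<^sup>N M v + integral\<^sup>N M u" if "M \<in> {A, B, C, D}" for M
    using that by (intro nn_integral_add) auto
  then show ?case using add.IH by (simp add: ac_simps)
next
  case (seq U)
  have mU: "U i \<in> borel_measurable M" if "M \<in> {A, B, C, D}" for M i
    using seq that by (auto cong: measurable_cong_sets)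
  have lim: "(\<lambda>i. integral\<^sup>N M (U i)) \<longlonglongrightarrow> integral\<^sup>N M (SUP i. U i)" if M: "M \<in> {A, B, C, D}" for M
  proof -
    have "integral\<^sup>N M (SUP i. U i) = integral\<^sup>N M (\<lambda>x. SUP i. U i x)"
      by (rule nn_integral_cong) (simp add: image_image)
    also have "\<dots> = (SUP i. integral\<^sup>N M (U i))"
      by (rule nn_integral_monotone_convergence_SUP[OF \<open>incseq U\<close> mU[OF M]])
    finally show ?thesis
      using seq(3) by (auto intro!: LIMSEQ_SUP nn_integral_mono simp: incseq_def le_fun_def)
  qed
  have "(\<lambda>i. integral\<^sup>N A (U i) + integral\<^sup>N B (U i)) \<longlonglongrightarrow> integral\<^sup>N A (SUP i. U i) + integral\<^sup>N B (SUP i. U i)"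
    by (intro tendsto_add lim) auto
  moreover have "(\<lambda>i. integral\<^sup>N C (U i) + integral\<^sup>N D (U i)) \<longlonglongrightarrow> integral\<^sup>N C (SUP i. U i) + integral\<^sup>N D (SUP i. U i)"
    by (intro tendsto_add lim) auto
  ultimately show ?case
    unfolding seq.IH by (rule LIMSEQ_unique)
qed

text \<open>The positive and the negative part of f are treated separately; integrability makes all
  eight values finite, so \<open>enn2real\<close> is additive on them.\<close>

lemma integral_add_measures:
  fixes f :: "'a \<Rightarrow> real"
  assumes sets: "sets B = sets A" "sets C = sets A" "sets D = sets A"
    and eq: "\<And>X. X \<in> sets A \<Longrightarrow> emeasure A X + emeasure B X = emeasure C X + emeasure D X"
    and int: "integrable A f" "integrable B f" "integrable C f" "integrable D f"
  shows "integral\<^sup>L A f + integral\<^sup>L B f = integral\<^sup>L C f + integral\<^sup>L D f"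
proof -
  have m: "f \<in> borel_measurable A" using int by auto
  have fin: "integral\<^sup>N M (\<lambda>x. ennreal (f x)) < top" "integral\<^sup>N M (\<lambda>x. ennreal (- f x)) < top"
    if "M \<in> {A, B, C, D}" for M
    using int that by (auto simp: real_integrable_def less_top)
  have e: "enn2real (integral\<^sup>N A g) + enn2real (integral\<^sup>N B g) =
       enn2real (integral\<^sup>N C g) + enn2real (integral\<^sup>N D g)"
    if "g \<in> borel_measurable A" "\<And>M. M \<in> {A, B, C, D} \<Longrightarrow> integral\<^sup>N M g < top" for g
    using nn_integral_add_measures[OF sets eq that(1)] that(2)
    by (simp flip: enn2real_plus)
  show ?thesis
    using e[of "\<lambda>x. ennreal (f x)"] e[of "\<lambda>x. ennreal (- f x)"] m fin int
    by (simp add: real_lebesgue_integral_def)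
qed

text \<open>By the Hahn decomposition there is a set Y such that P dominates N inside Y and N
  dominates P outside. The two positive parts at A are then (P - N) (A \<inter> Y) and (N - P) (A -
  Y), and both claims are arithmetic.\<close>

lemma emeasure_positive_part:
  assumes P: "sets P = borel_subsets K" "emeasure P K < top"
    and N: "sets N = borel_subsets K" "emeasure N K < top"
    and A: "A \<in> borel_subsets K"
  shows "emeasure (positive_part K (\<lambda>A. measure P A - measure N A)) A + emeasure N A
    = emeasure (positive_part K (\<lambda>A. measure N A - measure P A)) A + emeasure P A"
    and "emeasure (positive_part K (\<lambda>A. measure P A - measure N A)) A \<le> emeasure P A"
proof -
  have sp: "space P = K" "space N = K"
    using P(1) N(1) by (auto dest: sets_eq_imp_space_eq simp: space_restrict_space)
  interpret P: finite_measure P by standard (use P sp in auto)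
  interpret N: finite_measure N by standard (use N sp in auto)
  have KB: "borel_subsets K \<subseteq> Pow K" by (auto simp: sets_restrict_space)
  have eqs: "sets N = sets P" using P N by simp
  have ex: "\<exists>Y\<in>sets P. \<forall>A\<in>sets P. emeasure (positive_part K (\<lambda>A. measure P A - measure N A)) A
      = ennreal (measure P (A \<inter> Y) - measure N (A \<inter> Y)) \<and>
     emeasure (positive_part K (\<lambda>A. measure N A - measure P A)) A
      = ennreal (measure N (A - Y) - measure P (A - Y)) \<and>
     measure N (A \<inter> Y) \<le> measure P (A \<inter> Y) \<and> measure P (A - Y) \<le> measure N (A - Y)"
  proof -
    obtain Y where Y: "Y \<in> sets P" "\<And>X. X \<in> sets P \<Longrightarrow> X \<subseteq> Y \<Longrightarrow> measure N X \<le> measure P X"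
      "\<And>X. X \<in> sets P \<Longrightarrow> X \<inter> Y = {} \<Longrightarrow> measure P X \<le> measure N X"
      using finite_unsigned_Hahn_decomposition[OF P.finite_measure_axioms N.finite_measure_axioms eqs]
      by (auto simp: P.emeasure_eq_measure N.emeasure_eq_measure)
    \<comment> \<open>Stated for an arbitrary pair with Hahn set Z, because it is used for both
      orders of P and N.\<close>
    have gen: "emeasure (positive_part K (\<lambda>A. measure Q A - measure R A)) A
        = ennreal (measure Q (A \<inter> Z) - measure R (A \<inter> Z))"
      if Q: "finite_measure Q" "sets Q = sets P" and R: "finite_measure R" "sets R = sets P"
        and Z: "Z \<in> sets P" "\<And>X. X \<in> sets P \<Longrightarrow> X \<subseteq> Z \<Longrightarrow> measure R X \<le> measure Q X"
          "\<And>X. X \<in> sets P \<Longrightarrow> X \<inter> Z = {} \<Longrightarrow> measure Q X \<le> measure R X"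
        and A: "A \<in> sets P" for Q R Z A
    proof -
      interpret Q: finite_measure Q by fact
      interpret R: finite_measure R by fact
      \<comment> \<open>The supremum is attained at B \<inter> Z: dropping the part of E outside Z
        and adding the rest of B \<inter> Z can only increase the difference.\<close>
      have sup: "(SUP E\<in>{E \<in> borel_subsets K. E \<subseteq> B}. ennreal (measure Q E - measure R E))
         = ennreal (measure Q (B \<inter> Z) - measure R (B \<inter> Z))" if B: "B \<in> sets P" for B
      proof (rule antisym)
        show "(SUP E\<in>{E \<in> borel_subsets K. E \<subseteq> B}. ennreal (measure Q E - measure R E))
         \<le> ennreal (measure Q (B \<inter> Z) - measure R (B \<inter> Z))"
        proof (rule SUP_least, rule ennreal_leI)
          fix E assume E: "E \<in> {E \<in> borel_subsets K. E \<subseteq> B}"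
          then have EP: "E \<in> sets P" using P by simp
          let ?d = "\<lambda>X. measure Q X - measure R X"
          have split: "?d X = ?d (X \<inter> Y) + ?d (X - Y)" if "X \<in> sets P" "Y \<in> sets P" for X Y
            using Q.finite_measure_Union[of "X \<inter> Y" "X - Y"] R.finite_measure_Union[of "X \<inter> Y" "X - Y"] that Q R
            by (simp add: Int_Diff_Un Int_Diff_disjoint)
          have "?d E = ?d (E \<inter> Z) + ?d (E - Z)" by (rule split[OF EP Z(1)])
          moreover have "?d (E - Z) \<le> 0" using Z(3)[OF sets.Diff[OF EP Z(1)]] by (simp add: Int_commute)
          moreover have "?d (B \<inter> Z) = ?d (B \<inter> Z \<inter> E) + ?d (B \<inter> Z - E)"
            by (rule split[OF sets.Int[OF B Z(1)] EP])
          moreover have "B \<inter> Z \<inter> E = E \<inter> Z" using E by auto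
          moreover have "0 \<le> ?d (B \<inter> Z - E)" 
            using Z(2)[OF sets.Diff[OF sets.Int[OF B Z(1)] EP]] by (simp add: Diff_subset_conv le_infI2 sup.coboundedI2)
          ultimately show "?d E \<le> ?d (B \<inter> Z)" by simp
        qed
        show "ennreal (measure Q (B \<inter> Z) - measure R (B \<inter> Z))
          \<le> (SUP E\<in>{E \<in> borel_subsets K. E \<subseteq> B}. ennreal (measure Q E - measure R E))"
          using B Z(1) P by (intro SUP_upper) auto
      qed
      show ?thesis
        unfolding positive_part_def
      proof (subst emeasure_measure_of_sigma)
        show "sigma_algebra K (borel_subsets K)"
          using sets.sigma_algebra_axioms[of P] by (simp add: P sp)
        show "A \<in> borel_subsets K" using A P by simp
        show "positive (borel_subsets K) (\<lambda>A. SUP E\<in>{E \<in> borel_subsets K. E \<subseteq> A}. ennreal (measure Q E - measure R E))"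
          using sup[of "{}"] by (simp add: positive_def)
        show "countably_additive (borel_subsets K) (\<lambda>A. SUP E\<in>{E \<in> borel_subsets K. E \<subseteq> A}. ennreal (measure Q E - measure R E))"
        proof (rule countably_additiveI)
          fix X :: "nat \<Rightarrow> _" assume X: "range X \<subseteq> borel_subsets K" "disjoint_family X" "(\<Union>i. X i) \<in> borel_subsets K"
          have XP: "X i \<in> sets P" for i using X P by auto
          have "(\<lambda>i. measure M (X i \<inter> Z)) sums measure M (\<Union>i. X i \<inter> Z)" if "M = Q \<or> M = R" for M
          proof (rule finite_measure.finite_measure_UNION)
            show "finite_measure M" using that Q R by auto
            show "range (\<lambda>i. X i \<inter> Z) \<subseteq> sets M" using that XP Z(1) Q(2) R(2) by auto
            show "disjoint_family (\<lambda>i. X i \<inter> Z)" using X(2) by (auto simp: disjoint_family_on_def)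
          qed
          then have "(\<lambda>i. measure Q (X i \<inter> Z) - measure R (X i \<inter> Z)) sums
             (measure Q (\<Union>i. X i \<inter> Z) - measure R (\<Union>i. X i \<inter> Z))"
            by (intro sums_diff) auto
          moreover have "0 \<le> measure Q (X i \<inter> Z) - measure R (X i \<inter> Z)" for i
            using Z(2)[of "X i \<inter> Z"] XP Z(1) by auto
          ultimately have "(\<Sum>i. ennreal (measure Q (X i \<inter> Z) - measure R (X i \<inter> Z)))
            = ennreal (measure Q (\<Union>i. X i \<inter> Z) - measure R (\<Union>i. X i \<inter> Z))"
            by (intro suminf_ennreal_eq)
          moreover have UX: "(\<Union>i. X i) \<in> sets P" using X P by simp
          moreover have "(\<Union>i. X i \<inter> Z) = (\<Union>i. X i) \<inter> Z" by auto
          ultimately show "(\<Sum>i. SUP E\<in>{E \<in> borel_subsets K. E \<subseteq> X i}. ennreal (measure Q E - measure R E)) =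
            (SUP E\<in>{E \<in> borel_subsets K. E \<subseteq> (\<Union>i. X i)}. ennreal (measure Q E - measure R E))"
            unfolding sup[OF XP] sup[OF UX] by simp
        qed
      qed (use sup A in auto)
    qed
    \<comment> \<open>The complement of Y in K is the Hahn set of the reversed difference.\<close>
    have Yc: "K - Y \<in> sets P" using Y(1) sp by (metis sets.compl_sets)
    have "emeasure (positive_part K (\<lambda>A. measure N A - measure P A)) A
      = ennreal (measure N (A - Y) - measure P (A - Y))" if A: "A \<in> sets P" for A
    proof -
      have *: "A \<inter> (K - Y) = A - Y" using A KB P by auto
      have "emeasure (positive_part K (\<lambda>A. measure N A - measure P A)) A
        = ennreal (measure N (A \<inter> (K - Y)) - measure P (A \<inter> (K - Y)))"
      proof (rule gen[OF N.finite_measure_axioms eqs P.finite_measure_axioms refl Yc _ _ A])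
        fix X assume X: "X \<in> sets P"
        show "measure P X \<le> measure N X" if "X \<subseteq> K - Y" using that X by (intro Y(3)) auto
        show "measure N X \<le> measure P X" if "X \<inter> (K - Y) = {}" using that X KB P by (intro Y(2)) auto
      qed
      then show ?thesis using * by simp
    qed
    moreover have "emeasure (positive_part K (\<lambda>A. measure P A - measure N A)) A
      = ennreal (measure P (A \<inter> Y) - measure N (A \<inter> Y))" if "A \<in> sets P" for A
      by (rule gen[OF P.finite_measure_axioms refl N.finite_measure_axioms eqs Y that])
    moreover have "measure N (A \<inter> Y) \<le> measure P (A \<inter> Y)" if "A \<in> sets P" for A
      by (rule Y(2)[OF sets.Int[OF that Y(1)]]) blast
    moreover have "measure P (A - Y) \<le> measure N (A - Y)" if "A \<in> sets P" for A
      by (rule Y(3)[OF sets.Diff[OF that Y(1)]]) blast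
    ultimately show ?thesis
      by (intro bexI[OF _ Y(1)] ballI conjI)
  qed
  then obtain Y where Y: "Y \<in> sets P"
    "emeasure (positive_part K (\<lambda>A. measure P A - measure N A)) A
      = ennreal (measure P (A \<inter> Y) - measure N (A \<inter> Y))"
    "emeasure (positive_part K (\<lambda>A. measure N A - measure P A)) A
      = ennreal (measure N (A - Y) - measure P (A - Y))"
    "measure N (A \<inter> Y) \<le> measure P (A \<inter> Y)" "measure P (A - Y) \<le> measure N (A - Y)"
    using bspec[OF _ A[folded P(1)]] by blast
  have AP: "A \<in> sets P" "A \<in> sets N" "Y \<in> sets N" using A P N Y by auto
  have un: "measure P A = measure P (A \<inter> Y) + measure P (A - Y)"
    "measure N A = measure N (A \<inter> Y) + measure N (A - Y)"
    using P.finite_measure_Union[of "A \<inter> Y" "A - Y"] N.finite_measure_Union[of "A \<inter> Y" "A - Y"] AP Y(1)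
    by (simp_all add: Int_Diff_Un Int_Diff_disjoint)
  show "emeasure (positive_part K (\<lambda>A. measure P A - measure N A)) A + emeasure N A
    = emeasure (positive_part K (\<lambda>A. measure N A - measure P A)) A + emeasure P A"
    unfolding Y(2,3) P.emeasure_eq_measure N.emeasure_eq_measure
    using Y(4,5) un by (simp flip: ennreal_plus)
  show "emeasure (positive_part K (\<lambda>A. measure P A - measure N A)) A \<le> emeasure P A"
    unfolding Y(2) P.emeasure_eq_measure
    using measure_nonneg[of N "A \<inter> Y"] measure_nonneg[of P "A - Y"] un(1)
    by (intro ennreal_leI) linarith
qed

text \<open>This links the two notions of integral: the Riesz construction supplies P and N, while
  \<open>complex_integral\<close> refers to the Jordan parts of P - N, which may be strictly smaller
  than P and N.\<close>

lemma integral_positive_part_diff: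
  fixes u :: "'a::metric_space \<Rightarrow> complex"
  assumes K: "compact K" and u: "continuous_on K u"
    and P: "sets P = borel_subsets K" "emeasure P K < top"
    and N: "sets N = borel_subsets K" "emeasure N K < top"
  shows "integral\<^sup>L (positive_part K (\<lambda>A. measure P A - measure N A)) u
       - integral\<^sup>L (positive_part K (\<lambda>A. measure N A - measure P A)) u
       = integral\<^sup>L P u - integral\<^sup>L N u"
proof -
  let ?P = "positive_part K (\<lambda>A. measure P A - measure N A)"
  let ?N = "positive_part K (\<lambda>A. measure N A - measure P A)"
  have Kb: "K \<in> borel_subsets K"
    using K by (auto simp: sets_restrict_space borel_closed compact_imp_closed)
  have s: "sets (positive_part K \<nu>) = borel_subsets K" for \<nu>
    unfolding positive_part_def using sets.sigma_sets_eq[of "restrict_space borel K"]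
    by (subst sets_measure_of) (auto simp: space_restrict_space sets_restrict_space)
  have f: "emeasure ?P K < top" "emeasure ?N K < top"
    using emeasure_positive_part(2)[OF P N Kb] emeasure_positive_part(2)[OF N P Kb] P N
    by (auto intro: order_le_less_trans)
  have real: "integral\<^sup>L ?P v + integral\<^sup>L N v = integral\<^sup>L ?N v + integral\<^sup>L P v"
    if v: "continuous_on K v" for v :: "'a \<Rightarrow> real"
    by (rule integral_add_measures)
      (use emeasure_positive_part(1)[OF P N] s P N f v K in \<open>auto intro: integrable_continuous_compact\<close>)
  have c: "integral\<^sup>L M u = Complex (integral\<^sup>L M (\<lambda>x. Re (u x))) (integral\<^sup>L M (\<lambda>x. Im (u x)))"
    if "M \<in> {?P, ?N, P, N}" for M
  proof -
    have "integrable M u" using that s P N f u K by (auto intro: integrable_continuous_compact)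
    then show ?thesis by (simp add: complex_eq_iff)
  qed
  show ?thesis
    using real[of "\<lambda>x. Re (u x)"] real[of "\<lambda>x. Im (u x)"] u
    by (simp add: c complex_eq_iff continuous_on_Re continuous_on_Im)
qed

text \<open>A complex functional with real part \<open>u \<mapsto> J\<^sub>1 (Re u) + J\<^sub>2 (Im u)\<close> is represented by the
  complex measure \<open>\<mu>\<^sub>1 - \<i>\<mu>\<^sub>2\<close>, where \<open>\<mu>\<^sub>1\<close> and \<open>\<mu>\<^sub>2\<close> represent \<open>J\<^sub>1\<close> and \<open>J\<^sub>2\<close>.\<close>

lemma riesz_representation_complex:
  fixes K :: "'a::metric_space set" and J\<^sub>1 J\<^sub>2 :: "('a \<Rightarrow> real) \<Rightarrow> real"
  assumes K: "compact K" and c: "0 \<le> c"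
    and add: "\<And>J u v. J \<in> {J\<^sub>1, J\<^sub>2} \<Longrightarrow> continuous_on K u \<Longrightarrow> continuous_on K v \<Longrightarrow>
      J (\<lambda>x. u x + v x) = J u + J v"
    and scale: "\<And>J u r. J \<in> {J\<^sub>1, J\<^sub>2} \<Longrightarrow> continuous_on K u \<Longrightarrow> J (\<lambda>x. r * u x) = r * J u"
    and bound: "\<And>J u b. J \<in> {J\<^sub>1, J\<^sub>2} \<Longrightarrow> continuous_on K u \<Longrightarrow> 0 \<le> b \<Longrightarrow>
      (\<And>x. x \<in> K \<Longrightarrow> \<bar>u x\<bar> \<le> b) \<Longrightarrow> \<bar>J u\<bar> \<le> c * b"
  obtains \<mu> where "complex_measure_on K \<mu>" "total_variation K \<mu> \<le> ennreal (6 * c)"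
    "\<And>u. continuous_on K u \<Longrightarrow> complex_integral K \<mu> u =
      Complex (J\<^sub>1 (\<lambda>x. Re (u x)) + J\<^sub>2 (\<lambda>x. Im (u x))) (J\<^sub>1 (\<lambda>x. Im (u x)) - J\<^sub>2 (\<lambda>x. Re (u x)))"
proof -
  obtain P1 N1 where 1: "sets P1 = borel_subsets K" "sets N1 = borel_subsets K"
    "emeasure P1 K \<le> ennreal c" "emeasure N1 K \<le> ennreal (2 * c)"
    "\<And>u. continuous_on K u \<Longrightarrow> integrable P1 u \<and> integrable N1 u \<and> J\<^sub>1 u = integral\<^sup>L P1 u - integral\<^sup>L N1 u"
    by (rule riesz_representation_real[OF K c, of J\<^sub>1]) (simp_all add: add scale bound)
  obtain P2 N2 where 2: "sets P2 = borel_subsets K" "sets N2 = borel_subsets K"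
    "emeasure P2 K \<le> ennreal c" "emeasure N2 K \<le> ennreal (2 * c)"
    "\<And>u. continuous_on K u \<Longrightarrow> integrable P2 u \<and> integrable N2 u \<and> J\<^sub>2 u = integral\<^sup>L P2 u - integral\<^sup>L N2 u"
    by (rule riesz_representation_real[OF K c, of J\<^sub>2]) (simp_all add: add scale bound)
  let ?M = "{P1, N1, P2, N2}"
  have sets: "sets M = borel_subsets K" if "M \<in> ?M" for M using that 1 2 by auto
  have sp: "space M = K" if "M \<in> ?M" for M
    using sets[OF that] by (auto dest: sets_eq_imp_space_eq simp: space_restrict_space)
  have fin: "emeasure M K < top" if "M \<in> ?M" for M
    using that 1 2 by (auto intro: order_le_less_trans)
  have fm: "finite_measure M" if "M \<in> ?M" for M
    by standard (use fin[OF that] sp[OF that] in auto)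
  \<comment> \<open>The order in the imaginary part is reversed because the second signed measure
    enters with the factor -i.\<close>
  define \<mu> where "\<mu> A = Complex (measure P1 A - measure N1 A) (measure N2 A - measure P2 A)" for A
  show ?thesis
  proof (rule that)
    show "complex_measure_on K \<mu>"
      unfolding complex_measure_on_def
    proof (intro allI impI)
      fix A :: "nat \<Rightarrow> 'a set" assume A: "range A \<subseteq> borel_subsets K \<and> disjoint_family A"
      have "(\<lambda>n. measure M (A n)) sums measure M (\<Union>n. A n)" if "M \<in> ?M" for M
        by (rule finite_measure.finite_measure_UNION[OF fm[OF that]]) (use A sets[OF that] in auto)
      then show "(\<lambda>n. \<mu> (A n)) sums \<mu> (\<Union>n. A n)"
        unfolding \<mu>_def sums_complex_iff by (auto intro!: sums_diff)
    qed
    show "total_variation K \<mu> \<le> ennreal (6 * c)"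
      unfolding total_variation_def
    proof (rule SUP_least, clarify)
      fix X assume X: "finite X" "partition_on K X" "X \<subseteq> borel_subsets K"
      have cm: "cmod (\<mu> A) \<le> measure P1 A + measure N1 A + (measure P2 A + measure N2 A)" for A
        unfolding \<mu>_def 
        using measure_nonneg[of P1 A] measure_nonneg[of N1 A] measure_nonneg[of P2 A] measure_nonneg[of N2 A]
        by (intro order_trans[OF cmod_le]) (simp add: abs_if)
      have sum: "(\<Sum>A\<in>X. measure M A) = measure M K" if "M \<in> ?M" for M
      proof -
        have "measure M (\<Union>A\<in>X. A) = (\<Sum>A\<in>X. measure M A)"
          by (rule finite_measure.finite_measure_finite_Union[OF fm[OF that] X(1)])
            (use X sets[OF that] in \<open>auto simp: partition_on_def disjoint_def disjoint_family_on_def\<close>)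
        then show ?thesis using X(2) by (simp add: partition_on_def)
      qed
      have m: "measure P1 K \<le> c" "measure N1 K \<le> 2 * c" "measure P2 K \<le> c" "measure N2 K \<le> 2 * c"
        using 1 2 c by (auto simp: measure_def enn2real_leI)
      have "(\<Sum>A\<in>X. cmod (\<mu> A)) \<le> (\<Sum>A\<in>X. measure P1 A + measure N1 A + (measure P2 A + measure N2 A))"
        by (intro sum_mono cm)
      also have "\<dots> = measure P1 K + measure N1 K + (measure P2 K + measure N2 K)"
        by (simp add: sum.distrib sum)
      also have "\<dots> \<le> 6 * c" using m by simp
      finally have "ennreal (\<Sum>A\<in>X. cmod (\<mu> A)) \<le> ennreal (6 * c)" by (rule ennreal_leI)
      then show "(\<Sum>A\<in>X. ennreal (cmod (\<mu> A))) \<le> ennreal (6 * c)" by (simp add: sum_ennreal)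
    qed
    fix u :: "'a \<Rightarrow> complex" assume u: "continuous_on K u"
    have r: "continuous_on K (\<lambda>x. Re (u x))" "continuous_on K (\<lambda>x. Im (u x))"
      using u by (auto intro: continuous_on_Re continuous_on_Im)
    have "integrable M u" if "M \<in> ?M" for M
      by (rule integrable_continuous_compact[OF K u sets[OF that] fin[OF that]])
    then have c: "integral\<^sup>L M u = Complex (integral\<^sup>L M (\<lambda>x. Re (u x))) (integral\<^sup>L M (\<lambda>x. Im (u x)))"
      if "M \<in> ?M" for M
      using that by (simp add: complex_eq_iff)
    have "complex_integral K \<mu> u = (integral\<^sup>L P1 u - integral\<^sup>L N1 u) + \<i> * (integral\<^sup>L N2 u - integral\<^sup>L P2 u)"
      using integral_positive_part_diff[OF K u, of P1 N1] integral_positive_part_diff[OF K u, of N2 P2] sets fin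
      by (simp add: complex_integral_def \<mu>_def)
    then show "complex_integral K \<mu> u =
      Complex (J\<^sub>1 (\<lambda>x. Re (u x)) + J\<^sub>2 (\<lambda>x. Im (u x))) (J\<^sub>1 (\<lambda>x. Im (u x)) - J\<^sub>2 (\<lambda>x. Re (u x)))"
      using 1(5) 2(5) r by (simp add: c complex_eq_iff)
  qed
qed

section \<open>Hahn--Banach extension\<close>

text \<open>The functional to be extended is given by its graph \<open>R\<close>, a linear relation; it is
  single-valued because it is dominated by \<open>p\<close>.\<close>

lemma hahn_banach_functions:
  fixes W :: "('x \<Rightarrow> real) set" and p :: "('x \<Rightarrow> real) \<Rightarrow> real"
  assumes W_add: "\<And>u v. u \<in> W \<Longrightarrow> v \<in> W \<Longrightarrow> (\<lambda>x. u x + v x) \<in> W"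
    and W_scale: "\<And>u r. u \<in> W \<Longrightarrow> (\<lambda>x. r * u x) \<in> W"
    and p_add: "\<And>u v. u \<in> W \<Longrightarrow> v \<in> W \<Longrightarrow> p (\<lambda>x. u x + v x) \<le> p u + p v"
    and p_scale: "\<And>u r. u \<in> W \<Longrightarrow> 0 < r \<Longrightarrow> p (\<lambda>x. r * u x) = r * p u"
    and R_sub: "R \<subseteq> W \<times> UNIV" and R_zero: "((\<lambda>_. 0), 0) \<in> R"
    and R_add: "\<And>u v a b. (u, a) \<in> R \<Longrightarrow> (v, b) \<in> R \<Longrightarrow> ((\<lambda>x. u x + v x), a + b) \<in> R"
    and R_scale: "\<And>u a r. (u, a) \<in> R \<Longrightarrow> ((\<lambda>x. r * u x), r * a) \<in> R"
    and R_le: "\<And>u a. (u, a) \<in> R \<Longrightarrow> a \<le> p u"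
  obtains F where "\<And>u a. (u, a) \<in> R \<Longrightarrow> F u = a"
    "\<And>u v. u \<in> W \<Longrightarrow> v \<in> W \<Longrightarrow> F (\<lambda>x. u x + v x) = F u + F v"
    "\<And>u r. u \<in> W \<Longrightarrow> F (\<lambda>x. r * u x) = r * F u"
    "\<And>u. u \<in> W \<Longrightarrow> F u \<le> p u"
proof -
  define lin where "lin S \<longleftrightarrow> S \<subseteq> W \<times> UNIV \<and> ((\<lambda>_. 0), 0) \<in> S \<and>
    (\<forall>u a v b. (u, a) \<in> S \<longrightarrow> (v, b) \<in> S \<longrightarrow> ((\<lambda>x. u x + v x), a + b) \<in> S) \<and>
    (\<forall>u a r. (u, a) \<in> S \<longrightarrow> ((\<lambda>x. r * u x), r * a) \<in> S) \<and>
    (\<forall>u a. (u, a) \<in> S \<longrightarrow> a \<le> p u)" for S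
  define \<A> where "\<A> = {S. R \<subseteq> S \<and> lin S}"
  have "R \<in> \<A>"
    unfolding \<A>_def lin_def
    by (intro CollectI conjI allI impI subset_refl R_sub R_zero R_add R_scale R_le)
  have "\<Union>C \<in> \<A>" if C: "C \<noteq> {}" "subset.chain \<A> C" for C
  proof -
    have CA: "R \<subseteq> S" "lin S" if "S \<in> C" for S
      using C that by (auto simp: subset_chain_def \<A>_def)
    have dir: "\<exists>S\<in>C. x \<in> S \<and> y \<in> S" if "x \<in> \<Union>C" "y \<in> \<Union>C" for x y
    proof -
      obtain S T where "S \<in> C" "T \<in> C" "x \<in> S" "y \<in> T" using \<open>x \<in> \<Union>C\<close> \<open>y \<in> \<Union>C\<close> by blast
      moreover have "S \<subseteq> T \<or> T \<subseteq> S" using C(2) \<open>S \<in> C\<close> \<open>T \<in> C\<close> by (auto simp: subset_chain_def)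
      ultimately show ?thesis by blast
    qed
    have "lin (\<Union>C)"
      unfolding lin_def
    proof (intro conjI allI impI)
      show "\<Union>C \<subseteq> W \<times> UNIV" using CA(2) unfolding lin_def by blast
      show "((\<lambda>_. 0), 0) \<in> \<Union>C" using CA(2) C(1) unfolding lin_def by blast
      show "((\<lambda>x. u x + v x), a + b) \<in> \<Union>C" if "(u, a) \<in> \<Union>C" "(v, b) \<in> \<Union>C" for u a v b
        using dir[OF that] CA(2) unfolding lin_def by blast
      show "((\<lambda>x. r * u x), r * a) \<in> \<Union>C" if "(u, a) \<in> \<Union>C" for u a r
        using that CA(2) unfolding lin_def by blast
      show "a \<le> p u" if "(u, a) \<in> \<Union>C" for u a
        using that CA(2) unfolding lin_def by blast
    qed
    then show ?thesis using CA(1) C(1) by (auto simp: \<A>_def)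
  qed
  then obtain S where S: "S \<in> \<A>" and max: "\<And>T. T \<in> \<A> \<Longrightarrow> S \<subseteq> T \<Longrightarrow> T = S"
    using subset_Zorn_nonempty[of \<A>] \<open>R \<in> \<A>\<close> by (metis empty_iff)
  have S_W: "u \<in> W" if "(u, a) \<in> S" for u a using S that by (auto simp: \<A>_def lin_def)
  have S_zero: "((\<lambda>_. 0), 0) \<in> S" using S by (simp add: \<A>_def lin_def)
  have S_add: "((\<lambda>x. u x + v x), a + b) \<in> S" if "(u, a) \<in> S" "(v, b) \<in> S" for u v a b
    using S that unfolding \<A>_def lin_def by blast
  have S_scale: "((\<lambda>x. r * u x), r * a) \<in> S" if "(u, a) \<in> S" for u a r
    using S that unfolding \<A>_def lin_def by blast
  have S_le: "a \<le> p u" if "(u, a) \<in> S" for u a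
    using S that unfolding \<A>_def lin_def by blast
  have total: "\<exists>a. (w, a) \<in> S" if w: "w \<in> W" for w
  proof -
    \<comment> \<open>The classical one-dimensional extension: the value at w has to lie above every
      left side and below every right side, and subadditivity leaves room for it.\<close>
    have gap: "a - p (\<lambda>x. u x + (-1) * w x) \<le> p (\<lambda>x. v x + w x) - b"
      if "(u, a) \<in> S" "(v, b) \<in> S" for u a v b
    proof -
      have uv: "u \<in> W" "v \<in> W" using that S_W by auto
      have "a + b \<le> p (\<lambda>x. u x + v x)" using S_le[OF S_add[OF that]] .
      also have "(\<lambda>x. u x + v x) = (\<lambda>x. (u x + (-1) * w x) + (v x + w x))" by auto
      also have "p \<dots> \<le> p (\<lambda>x. u x + (-1) * w x) + p (\<lambda>x. v x + w x)"
        by (intro p_add W_add W_scale uv w)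
      finally show ?thesis by simp
    qed
    define c where "c = (SUP (u, a)\<in>S. a - p (\<lambda>x. u x + (-1) * w x))"
    have lower: "a - p (\<lambda>x. u x + (-1) * w x) \<le> c" if "(u, a) \<in> S" for u a
    proof -
      have "bdd_above ((\<lambda>(u, a). a - p (\<lambda>x. u x + (-1) * w x)) ` S)"
        by (rule bdd_aboveI2[of _ _ "p (\<lambda>x. 0 + w x) - 0"]) (use gap[OF _ S_zero] in auto)
      then show ?thesis
        unfolding c_def using cSUP_upper[OF that, of "\<lambda>(u, a). a - p (\<lambda>x. u x + (-1) * w x)"] by simp
    qed
    have upper: "c \<le> p (\<lambda>x. v x + w x) - b" if "(v, b) \<in> S" for v b
      unfolding c_def by (rule cSUP_least) (use gap[OF _ that] S_zero in auto)
    define T where "T = {((\<lambda>x. u x + t * w x), a + t * c) | u a t. (u, a) \<in> S}"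
    have TI: "((\<lambda>x. u x + t * w x), a + t * c) \<in> T" if "(u, a) \<in> S" for u a t
      unfolding T_def by (rule CollectI, intro exI conjI) (rule refl, rule that)
    have ST: "(u, a) \<in> T" if "(u, a) \<in> S" for u a
    proof -
      show ?thesis using TI[OF that, of 0] by simp
    qed
    \<comment> \<open>Dividing by the modulus of t reduces the claim to \<open>upper\<close> for t >
      0 and to \<open>lower\<close> for t < 0.\<close>
    have le: "a + t * c \<le> p (\<lambda>x. u x + t * w x)" if ua: "(u, a) \<in> S" for u a t
    proof (cases t "0::real" rule: linorder_cases)
      case equal
      then show ?thesis using S_le[OF ua] by simp
    next
      case greater
      have ua': "((\<lambda>x. inverse t * u x), inverse t * a) \<in> S" by (rule S_scale[OF ua])
      have "p (\<lambda>x. t * (inverse t * u x + w x)) = t * p (\<lambda>x. inverse t * u x + w x)"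
        using S_W[OF ua'] w greater by (intro p_scale W_add)
      also have "(\<lambda>x. t * (inverse t * u x + w x)) = (\<lambda>x. u x + t * w x)"
        using greater by (auto simp: distrib_left)
      also have "t * (inverse t * a + c) \<le> t * p (\<lambda>x. inverse t * u x + w x)"
        using upper[OF ua'] greater by (intro mult_left_mono) auto
      moreover have "t * (inverse t * a + c) = a + t * c"
        using greater by (simp add: distrib_left)
      ultimately show ?thesis by simp
    next
      case less
      define s where "s = - t"
      have s: "0 < s" using less by (simp add: s_def)
      have ua': "((\<lambda>x. inverse s * u x), inverse s * a) \<in> S" by (rule S_scale[OF ua])
      have "p (\<lambda>x. s * (inverse s * u x + (-1) * w x)) = s * p (\<lambda>x. inverse s * u x + (-1) * w x)"
        by (rule p_scale[OF W_add[OF S_W[OF ua'] W_scale[OF w]] s])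
      also have "(\<lambda>x. s * (inverse s * u x + (-1) * w x)) = (\<lambda>x. u x + t * w x)"
        using s by (auto simp: right_diff_distrib s_def)
      also have "s * (inverse s * a - c) \<le> s * p (\<lambda>x. inverse s * u x + (-1) * w x)"
        using lower[OF ua'] s by (intro mult_left_mono) auto
      moreover have "s * (inverse s * a - c) = a + t * c"
        using s by (simp add: right_diff_distrib s_def)
      ultimately show ?thesis by simp
    qed
    have "lin T"
      unfolding lin_def
    proof (intro conjI allI impI)
      show "T \<subseteq> W \<times> UNIV" using S_W w W_add W_scale by (auto simp: T_def)
      show "((\<lambda>_. 0), 0) \<in> T" by (rule ST[OF S_zero])
    next
      fix u a v b assume "(u, a) \<in> T" "(v, b) \<in> T"
      then obtain u' a' s v' b' t where *: "(u', a') \<in> S" "(v', b') \<in> S"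
        "u = (\<lambda>x. u' x + s * w x)" "a = a' + s * c" "v = (\<lambda>x. v' x + t * w x)" "b = b' + t * c"
        unfolding T_def by blast
      have "((\<lambda>x. (u' x + v' x) + (s + t) * w x), (a' + b') + (s + t) * c) \<in> T"
        by (rule TI[OF S_add[OF *(1,2)]])
      moreover have "(\<lambda>x. (u' x + v' x) + (s + t) * w x) = (\<lambda>x. u x + v x)"
        "(a' + b') + (s + t) * c = a + b"
        using * by (auto simp: algebra_simps)
      ultimately show "((\<lambda>x. u x + v x), a + b) \<in> T" by simp
    next
      fix u a r assume "(u, a) \<in> T"
      then obtain u' a' s where *: "(u', a') \<in> S" "u = (\<lambda>x. u' x + s * w x)" "a = a' + s * c"
        unfolding T_def by blast
      have "((\<lambda>x. r * u' x + (r * s) * w x), r * a' + (r * s) * c) \<in> T"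
        by (rule TI[OF S_scale[OF *(1)]])
      moreover have "(\<lambda>x. r * u' x + (r * s) * w x) = (\<lambda>x. r * u x)" "r * a' + (r * s) * c = r * a"
        using * by (auto simp: algebra_simps)
      ultimately show "((\<lambda>x. r * u x), r * a) \<in> T" by simp
    next
      fix u a assume "(u, a) \<in> T"
      then show "a \<le> p u" using le unfolding T_def by blast
    qed
    moreover have "S \<subseteq> T" using ST by auto
    ultimately have "T = S" using S by (intro max) (auto simp: \<A>_def)
    then have "(w, c) \<in> S" using TI[OF S_zero, of 1] by simp
    then show ?thesis ..
  qed
  have single: "a = b" if "(u, a) \<in> S" "(u, b) \<in> S" for u a b
  proof -
    have small: "d \<le> 0" if "((\<lambda>_. 0), d) \<in> S" for d
    proof (rule ccontr)
      assume "\<not> d \<le> 0"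
      \<comment> \<open>Every multiple of d is also a value at 0; this one is |p 0| + 1 and breaks
        the domination by p.\<close>
      define r where "r = (\<bar>p (\<lambda>_. 0)\<bar> + 1) / d"
      have "((\<lambda>_. 0), r * d) \<in> S" using S_scale[OF that, of r] by simp
      then have "r * d \<le> p (\<lambda>_. 0)" by (rule S_le)
      then show False using \<open>\<not> d \<le> 0\<close> by (simp add: r_def)
    qed
    have "((\<lambda>_. 0), a - b) \<in> S" "((\<lambda>_. 0), b - a) \<in> S"
      using S_add[OF that(1) S_scale[OF that(2), of "-1"]] S_add[OF that(2) S_scale[OF that(1), of "-1"]]
      by simp_all
    from this[THEN small] show ?thesis by simp
  qed
  define F where "F u = (THE a. (u, a) \<in> S)" for u
  have F: "F u = a" if "(u, a) \<in> S" for u a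
    unfolding F_def using that single by blast
  have FS: "(u, F u) \<in> S" if "u \<in> W" for u
    using total[OF that] F by auto
  show ?thesis
  proof (rule that)
    show "F u = a" if "(u, a) \<in> R" for u a
      using that S by (intro F) (auto simp: \<A>_def)
    show "F (\<lambda>x. u x + v x) = F u + F v" if "u \<in> W" "v \<in> W" for u v
      by (intro F S_add FS that)
    show "F (\<lambda>x. r * u x) = r * F u" if "u \<in> W" for u r
      by (intro F S_scale FS that)
    show "F u \<le> p u" if "u \<in> W" for u
      by (intro S_le FS that)
  qed
qed

section \<open>Locally convex topologies and equicontinuity\<close>

text \<open>The generating balls have arbitrary centres. A ball of radius e around f that contains 0
  is replaced by the ball of radius e - p (-f) around 0; this is the only use of the triangle
  inequality, assumed in exactly the form needed.\<close>

lemma seminorm_topology_nhd_zero: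
  assumes sub: "\<And>p f g. p \<in> P \<Longrightarrow> f \<in> V \<Longrightarrow> g \<in> V \<Longrightarrow> p (\<lambda>t. g t - f t) \<le> p g + p (\<lambda>t. - f t)"
    and U: "openin (seminorm_topology V P) U" "(\<lambda>_. 0) \<in> U"
  obtains F e where "finite F" "F \<subseteq> P" "0 < e" "{g \<in> V. \<forall>p\<in>F. p g < e} \<subseteq> U"
proof -
  have "generate_topology_on (insert V {{g \<in> V. p (\<lambda>t. g t - f t) < e} | f p e. f \<in> V \<and> p \<in> P \<and> e > 0}) U"
    using U(1) by (simp add: seminorm_topology_def openin_topology_generated_by)
  then have "\<exists>F e. finite F \<and> F \<subseteq> P \<and> 0 < e \<and> {g \<in> V. \<forall>p\<in>F. p g < e} \<subseteq> U"
    using U(2)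
  proof induction
    case Empty
    then show ?case by simp
  next
    case (Int a b)
    then obtain F e F' e' where *: "finite F" "F \<subseteq> P" "0 < e" "{g \<in> V. \<forall>p\<in>F. p g < e} \<subseteq> a"
      "finite F'" "F' \<subseteq> P" "0 < e'" "{g \<in> V. \<forall>p\<in>F'. p g < e'} \<subseteq> b"
      by blast
    show ?case
      by (rule exI[of _ "F \<union> F'"], rule exI[of _ "min e e'"]) (use * in auto)
  next
    case (UN C)
    then obtain k where "k \<in> C" "(\<lambda>_. 0) \<in> k" by blast
    with UN.IH[OF this] show ?case by (meson Union_upper order_trans)
  next
    case (Basis s)
    then consider "s = V" | f p e where "f \<in> V" "p \<in> P" "s = {g \<in> V. p (\<lambda>t. g t - f t) < e}"
      by blast
    then show ?case
    proof cases
      case 1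
      then show ?thesis by (intro exI[of _ "{}"] exI[of _ 1]) auto
    next
      case 2
      have "p (\<lambda>t. - f t) < e" using Basis 2 by simp
      moreover have "{g \<in> V. \<forall>p\<in>{p}. p g < e - p (\<lambda>t. - f t)} \<subseteq> s"
        using sub[OF 2(2,1)] 2 by force
      ultimately show ?thesis
        using 2 by (intro exI[of _ "{p}"] exI[of _ "e - p (\<lambda>t. - f t)"]) auto
    qed
  qed
  then show ?thesis using that by blast
qed

text \<open>The supremum over S is one of the defining seminorms of the strong dual, so its unit
  ball is a neighbourhood of 0 and absorbs B.\<close>

lemma strong_dual_bounded:
  assumes B: "vn_bounded (strong_dual T) B" and S: "vn_bounded T S" and zero: "(\<lambda>_. 0) \<in> topspace T"
  obtains r where "\<And>f \<phi>. f \<in> B \<Longrightarrow> \<phi> \<in> S \<Longrightarrow> cmod (f \<phi>) \<le> r"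
proof (cases "S = {}")
  case True
  then show ?thesis using that by blast
next
  case False
  define p where "p f = (SUP \<phi>\<in>S. cmod (f \<phi>))" for f :: "('a \<Rightarrow> complex) \<Rightarrow> complex"
  \<comment> \<open>A real \<open>SUP\<close> is an upper bound only if the set is bounded above.
    Here it is, as S is absorbed by the preimage of the unit disc under g.\<close>
  have bdd: "bdd_above ((\<lambda>\<phi>. cmod (g \<phi>)) ` S)" if g: "g \<in> dual_space T" for g
  proof -
    have scale: "g (\<lambda>x. c * \<phi> x) = c * g \<phi>" if "\<phi> \<in> topspace T" for c \<phi>
      using g that by (simp add: dual_space_def)
    define U where "U = {\<phi> \<in> topspace T. g \<phi> \<in> ball 0 1}"
    have "openin T U"
      unfolding U_def using g by (intro openin_continuous_map_preimage[of T euclidean]) (auto simp: dual_space_def)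
    moreover have "(\<lambda>_. 0) \<in> U"
      using scale[OF zero, of 0] zero by (simp add: U_def)
    ultimately obtain r where r: "r > 0" "S \<subseteq> (\<lambda>f t. complex_of_real r * f t) ` U"
      using S unfolding vn_bounded_def by blast
    show ?thesis
    proof (rule bdd_aboveI2)
      fix \<phi> assume "\<phi> \<in> S"
      then obtain \<psi> where \<psi>: "\<psi> \<in> U" "\<phi> = (\<lambda>t. complex_of_real r * \<psi> t)" using r by blast
      then have "g \<phi> = r * g \<psi>" using scale by (simp add: U_def)
      then show "cmod (g \<phi>) \<le> r * 1"
        using \<psi>(1) r(1) by (simp add: U_def norm_mult)
    qed
  qed
  define U where "U = {g \<in> dual_space T. p (\<lambda>t. g t - (\<lambda>_. 0) t) < 1}"
  have z: "(\<lambda>_. 0) \<in> dual_space T" by (simp add: dual_space_def)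
  have "openin (strong_dual T) U"
    unfolding strong_dual_def seminorm_topology_def
  proof (rule topology_generated_by_Basis, rule insertI2)
    have pP: "p \<in> {(\<lambda>f. SUP \<phi>\<in>S. cmod (f \<phi>)) | S. vn_bounded T S \<and> S \<noteq> {}}"
      using S False unfolding p_def by blast
    show "U \<in> {{g \<in> dual_space T. p (\<lambda>t. g t - f t) < e} |f p e.
        f \<in> dual_space T \<and> p \<in> {\<lambda>f. SUP \<phi>\<in>S. cmod (f \<phi>) |S. vn_bounded T S \<and> S \<noteq> {}} \<and> 0 < e}"
      unfolding U_def
      by (rule CollectI, rule exI[of _ "\<lambda>_. 0"], rule exI[of _ p], rule exI[of _ "1::real"])
        (intro conjI refl z zero_less_one pP)
  qed
  moreover have "(\<lambda>_. 0) \<in> U"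
    using z False by (simp add: U_def p_def)
  ultimately obtain r where r: "r > 0" "B \<subseteq> (\<lambda>f t. complex_of_real r * f t) ` U"
    using B unfolding vn_bounded_def by blast
  show ?thesis
  proof (rule that)
    fix f \<phi> assume f: "f \<in> B" and \<phi>: "\<phi> \<in> S"
    then obtain g where g: "g \<in> U" "f = (\<lambda>t. complex_of_real r * g t)" using r by blast
    have "cmod (g \<phi>) \<le> p g"
      unfolding p_def using g(1) by (intro cSUP_upper \<phi> bdd) (simp add: U_def)
    also have "\<dots> < 1" using g(1) by (simp add: U_def)
    finally show "cmod (f \<phi>) \<le> r * 1"
      using r(1) g(2) by (simp add: norm_mult)
  qed
qed

section \<open>Exhaustion of an open set by regular compact sets\<close>

lemma regular_compact_exhaustion:
  fixes \<Omega> :: "'a::euclidean_space set"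
  assumes \<Omega>: "open \<Omega>"
  obtains K :: "nat \<Rightarrow> 'a set" where "\<And>n. regular_compact (K n)" "\<And>n. K n \<subseteq> \<Omega>"
    "\<And>m n. m \<le> n \<Longrightarrow> K m \<subseteq> K n" "\<And>L. compact L \<Longrightarrow> L \<subseteq> \<Omega> \<Longrightarrow> \<exists>n. L \<subseteq> K n"
proof -
  \<comment> \<open>Intersecting over the points outside \<Omega>, instead of using the distance to
    the complement, includes the case that \<Omega> is the whole space.\<close>
  define V where "V n = {x. norm x \<le> real n} \<inter> (\<Inter>y\<in>- \<Omega>. {x. 1 / (real n + 1) \<le> dist x y})" for n
  have cV: "closed (V n)" for n
    unfolding V_def by (intro closed_Int closed_INT ballI closed_Collect_le continuous_intros)
  have VO: "V n \<subseteq> \<Omega>" for n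
  proof
    fix x assume x: "x \<in> V n"
    show "x \<in> \<Omega>"
    proof (rule ccontr)
      assume "x \<notin> \<Omega>"
      then have "1 / (real n + 1) \<le> dist x x" using x unfolding V_def by blast
      then show False by simp
    qed
  qed
  have Vmono: "V m \<subseteq> V n" if "m \<le> n" for m n
  proof -
    have "1 / (real n + 1) \<le> 1 / (real m + 1)" using that by (simp add: field_simps)
    then have "{x. 1 / (real m + 1) \<le> dist x y} \<subseteq> {x. 1 / (real n + 1) \<le> dist x y}" for y :: 'a
      by (auto intro: order_trans)
    moreover have "{x :: 'a. norm x \<le> real m} \<subseteq> {x. norm x \<le> real n}"
      using that by (auto intro: order_trans)
    ultimately show ?thesis unfolding V_def by (intro Int_mono INF_mono) blast+
  qed
  have cover: "\<exists>n. x \<in> interior (V n)" if "x \<in> \<Omega>" for x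
  proof -
    obtain e where e: "0 < e" "ball x e \<subseteq> \<Omega>" by (rule openE[OF \<Omega> \<open>x \<in> \<Omega>\<close>])
    obtain n where n: "max (norm x + e) (2 / e) < real n" using reals_Archimedean2 by blast
    have "ball x (e/2) \<subseteq> V n"
    proof
      fix y assume y: "y \<in> ball x (e/2)"
      have "norm y \<le> norm x + dist x y" 
        using norm_triangle_sub[of y x] by (simp add: dist_norm norm_minus_commute)
      then have "norm y \<le> real n" using y n e by auto
      moreover have "1 / (real n + 1) \<le> dist y z" if "z \<in> - \<Omega>" for z
      proof -
        have "e \<le> dist x z" using e(2) that by (auto simp: subset_eq not_le)
        then have "e / 2 \<le> dist y z" using y dist_triangle[of x z y] by (simp add: dist_commute)
        moreover have "1 / (real n + 1) \<le> e / 2" using n e by (simp add: field_simps)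
        ultimately show ?thesis by linarith
      qed
      ultimately show "y \<in> V n" by (auto simp: V_def)
    qed
    then have "x \<in> interior (V n)" using e(1) by (intro interiorI[of "ball x (e/2)"]) auto
    then show ?thesis ..
  qed
  \<comment> \<open>This enforces regularity. Covering is unaffected, since the interiors of the V n
    already cover \<Omega>.\<close>
  let ?K = "\<lambda>n. closure (interior (V n))"
  have KV: "?K n \<subseteq> V n" for n
    using cV[of n] by (metis closure_minimal interior_subset)
  show ?thesis
  proof (rule that)
    fix n
    have "bounded (V n)" by (auto simp: V_def bounded_iff)
    then have "compact (?K n)"
      using bounded_subset[OF _ KV] by (simp add: compact_eq_bounded_closed)
    moreover have "closure (interior (?K n)) = ?K n"
    proof (rule antisym)
      show "closure (interior (?K n)) \<subseteq> ?K n" by (metis closed_closure closure_minimal interior_subset)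
      show "?K n \<subseteq> closure (interior (?K n))"
        by (intro closure_mono interior_maximal closure_subset open_interior)
    qed
    ultimately show "regular_compact (?K n)" by (simp add: regular_compact_def)
    show "?K n \<subseteq> \<Omega>" using KV VO by blast
  next
    show "?K m \<subseteq> ?K n" if "m \<le> n" for m n
      by (intro closure_mono interior_mono Vmono that)
  next
    fix L :: "'a set" assume L: "compact L" "L \<subseteq> \<Omega>"
    have "L \<subseteq> (\<Union>n. interior (V n))" using cover L(2) by blast
    then obtain C where C: "finite C" "L \<subseteq> (\<Union>n\<in>C. interior (V n))"
      using compactE_image[OF L(1), of UNIV "\<lambda>n. interior (V n)"] by auto
    define n where "n = Max (insert 0 C)"
    have "m \<le> n" if "m \<in> C" for m
      unfolding n_def using C(1) that by (intro Max_ge) auto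
    then have "interior (V m) \<subseteq> ?K n" if "m \<in> C" for m
      using that closure_subset interior_mono[OF Vmono] by (meson order_trans)
    then show "\<exists>n. L \<subseteq> ?K n" using C(2) by blast
  qed
qed

section \<open>Linearity of iterated partial derivatives\<close>

text \<open>The identity for g is known on \<Omega> only; openness keeps the coordinate line near x
  inside \<Omega>, so the derivative does not see the rest.\<close>

lemma has_vector_derivative_partial_lincomb:
  fixes u v g :: "real ^ 'd::finite \<Rightarrow> complex"
  assumes \<Omega>: "open \<Omega>" "x \<in> \<Omega>" and g: "\<And>y. y \<in> \<Omega> \<Longrightarrow> g y = a * u y + b * v y"
    and u: "(\<lambda>t. u (x + t *\<^sub>R axis i 1)) differentiable (at 0)"
    and v: "(\<lambda>t. v (x + t *\<^sub>R axis i 1)) differentiable (at 0)"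
  shows "((\<lambda>t. g (x + t *\<^sub>R axis i 1)) has_vector_derivative a * partial i u x + b * partial i v x) (at 0)"
proof (rule has_vector_derivative_transform_within_open)
  show "((\<lambda>t. a * u (x + t *\<^sub>R axis i 1) + b * v (x + t *\<^sub>R axis i 1)) has_vector_derivative
      a * partial i u x + b * partial i v x) (at 0)"
    unfolding partial_def
    by (intro has_vector_derivative_add has_vector_derivative_mult_right)
      (use u v in \<open>auto simp: vector_derivative_works\<close>)
  show "open ((\<lambda>t. x + t *\<^sub>R axis i 1) -` \<Omega>)"
    by (intro open_vimage \<Omega> continuous_intros)
qed (use \<Omega> g in auto)

text \<open>Induction on the list of directions. A further derivative at x depends on values near x,
  so the induction hypothesis is needed at all points of \<Omega>.\<close>

lemma
  fixes \<phi> \<psi> :: "real ^ 'd::finite \<Rightarrow> complex"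
  assumes \<Omega>: "open \<Omega>" and \<phi>: "smooth_on \<Omega> \<phi>" and \<psi>: "smooth_on \<Omega> \<psi>"
  shows partials_lincomb: "x \<in> \<Omega> \<Longrightarrow>
      partials is (\<lambda>x. a * \<phi> x + b * \<psi> x) x = a * partials is \<phi> x + b * partials is \<psi> x"
    and smooth_on_lincomb: "smooth_on \<Omega> (\<lambda>x. a * \<phi> x + b * \<psi> x)"
proof -
  have eq: "partials is (\<lambda>x. a * \<phi> x + b * \<psi> x) x = a * partials is \<phi> x + b * partials is \<psi> x"
    if "x \<in> \<Omega>" for x "is"
    using that
  proof (induction "is" arbitrary: x)
    case Nil
    then show ?case by (simp add: partials_def)
  next
    case (Cons i "is")
    have "partial i (partials is (\<lambda>x. a * \<phi> x + b * \<psi> x)) x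
      = a * partial i (partials is \<phi>) x + b * partial i (partials is \<psi>) x"
      unfolding partial_def[of i "partials is (\<lambda>x. a * \<phi> x + b * \<psi> x)"]
      by (intro vector_derivative_at has_vector_derivative_partial_lincomb[OF \<Omega> Cons.prems Cons.IH])
        (use \<phi> \<psi> Cons.prems in \<open>auto simp: smooth_on_def\<close>)
    then show ?case by (simp add: partials_def)
  qed
  then show "x \<in> \<Omega> \<Longrightarrow>
      partials is (\<lambda>x. a * \<phi> x + b * \<psi> x) x = a * partials is \<phi> x + b * partials is \<psi> x"
    by simp
  show "smooth_on \<Omega> (\<lambda>x. a * \<phi> x + b * \<psi> x)"
    unfolding smooth_on_def
  proof (intro allI conjI ballI)
    fix "is"
    have "continuous_on \<Omega> (\<lambda>x. a * partials is \<phi> x + b * partials is \<psi> x)"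
      using \<phi> \<psi> by (intro continuous_intros) (auto simp: smooth_on_def)
    then show "continuous_on \<Omega> (partials is (\<lambda>x. a * \<phi> x + b * \<psi> x))"
      using eq by (simp cong: continuous_on_cong)
    fix i x assume x: "x \<in> \<Omega>"
    show "(\<lambda>t. partials is (\<lambda>x. a * \<phi> x + b * \<psi> x) (x + t *\<^sub>R axis i 1)) differentiable at 0"
      by (rule differentiableI_vector, rule has_vector_derivative_partial_lincomb[OF \<Omega> x eq])
        (use \<phi> \<psi> x in \<open>auto simp: smooth_on_def\<close>)
  qed
qed

lemma partials_zero: "partials is (\<lambda>_. 0) = (\<lambda>_. 0)"
  by (induction "is") (auto simp: partials_def partial_def)

text \<open>These are the finite index sets beyond which the remainder of the series will be
  small.\<close>

lemma finite_mi_size_le: "finite {\<alpha> :: nat ^ 'd::finite. mi_size \<alpha> \<le> n}"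
proof (rule finite_imageD)
  show "finite (vec_nth ` {\<alpha> :: nat ^ 'd. mi_size \<alpha> \<le> n})"
  proof (rule finite_subset)
    have "\<alpha> $ i \<le> mi_size \<alpha>" for \<alpha> :: "nat ^ 'd" and i
      unfolding mi_size_def by (rule member_le_sum) auto
    then show "vec_nth ` {\<alpha> :: nat ^ 'd. mi_size \<alpha> \<le> n} \<subseteq> (UNIV \<rightarrow>\<^sub>E {..n})"
      by (auto intro: order_trans)
    show "finite ((UNIV :: 'd set) \<rightarrow>\<^sub>E {..n})" by (intro finite_PiE) auto
  qed
qed (auto intro: inj_onI simp: vec_eq_iff)

section \<open>The norms of the Beurling space and equicontinuity\<close>

locale beurling =
  fixes M :: "nat \<Rightarrow> real" and \<Omega> :: "(real ^ 'd::finite) set"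
  assumes M_pos: "\<And>p. 0 < M p" and open_\<Omega>: "open \<Omega>"
begin

abbreviation E where "E \<equiv> beurling_space M \<Omega>"

text \<open>Since \<open>enn2real\<close> sends infinity to 0, this is the true norm only where
  \<open>um_norm\<close> is finite; on \<open>E\<close> that holds for all admissible K and
  h.\<close>

definition nrm :: "(real ^ 'd) set \<Rightarrow> real \<Rightarrow> (real ^ 'd \<Rightarrow> complex) \<Rightarrow> real" where
  "nrm K h \<phi> = enn2real (um_norm M K h \<phi>)"

definition adm :: "(real ^ 'd) set \<Rightarrow> real \<Rightarrow> bool" where
  "adm K h \<longleftrightarrow> regular_compact K \<and> K \<subseteq> \<Omega> \<and> 0 < h"

lemma nrm_nonneg: "0 \<le> nrm K h \<phi>"
  by (simp add: nrm_def)

lemma um_norm_le: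
  assumes "0 < h" "0 \<le> c"
    and "\<And>\<alpha> x. x \<in> K \<Longrightarrow> cmod (mderiv \<alpha> \<phi> x) \<le> c * (h ^ mi_size \<alpha> * M (mi_size \<alpha>))"
  shows "um_norm M K h \<phi> \<le> ennreal c"
  unfolding um_norm_def
  using assms M_pos by (intro SUP_least ennreal_leI) (simp add: divide_le_eq)

lemma nrm_le:
  assumes "0 < h" "0 \<le> c"
    and "\<And>\<alpha> x. x \<in> K \<Longrightarrow> cmod (mderiv \<alpha> \<phi> x) \<le> c * (h ^ mi_size \<alpha> * M (mi_size \<alpha>))"
  shows "nrm K h \<phi> \<le> c"
  unfolding nrm_def using um_norm_le[OF assms] assms(2) by (rule enn2real_leI[rotated])

lemma mderiv_le_nrm:
  assumes \<phi>: "\<phi> \<in> E" and K: "adm K h" and x: "x \<in> K"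
  shows "cmod (mderiv \<alpha> \<phi> x) \<le> nrm K h \<phi> * (h ^ mi_size \<alpha> * M (mi_size \<alpha>))"
proof -
  have fin: "um_norm M K h \<phi> < \<infinity>" and h: "0 < h" using \<phi> K by (auto simp: beurling_space_def adm_def)
  have "ennreal (cmod (mderiv \<alpha> \<phi> x) / (h ^ mi_size \<alpha> * M (mi_size \<alpha>))) \<le> um_norm M K h \<phi>"
    unfolding um_norm_def by (rule SUP_upper2[of \<alpha>], simp, rule SUP_upper[OF x])
  then have "cmod (mderiv \<alpha> \<phi> x) / (h ^ mi_size \<alpha> * M (mi_size \<alpha>)) \<le> nrm K h \<phi>"
    unfolding nrm_def using fin h M_pos
    by (metis enn2real_ennreal enn2real_mono infinity_ennreal_def less_imp_le divide_nonneg_pos mult_pos_pos norm_ge_zero zero_less_power)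
  then show ?thesis using h M_pos by (simp add: divide_le_eq)
qed

lemma mderiv_lincomb:
  assumes "\<phi> \<in> E" "\<psi> \<in> E" "x \<in> \<Omega>"
  shows "mderiv \<alpha> (\<lambda>x. a * \<phi> x + b * \<psi> x) x = a * mderiv \<alpha> \<phi> x + b * mderiv \<alpha> \<psi> x"
  unfolding mderiv_def using assms open_\<Omega>
  by (intro partials_lincomb) (auto simp: beurling_space_def)

lemma mderiv_lincomb_le:
  assumes \<phi>: "\<phi> \<in> E" and \<psi>: "\<psi> \<in> E" and K: "adm K h" and x: "x \<in> K"
  shows "cmod (mderiv \<alpha> (\<lambda>x. a * \<phi> x + b * \<psi> x) x)
    \<le> (cmod a * nrm K h \<phi> + cmod b * nrm K h \<psi>) * (h ^ mi_size \<alpha> * M (mi_size \<alpha>))"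
proof -
  have "cmod (a * mderiv \<alpha> \<phi> x + b * mderiv \<alpha> \<psi> x)
      \<le> cmod a * cmod (mderiv \<alpha> \<phi> x) + cmod b * cmod (mderiv \<alpha> \<psi> x)"
    by (rule order_trans[OF norm_triangle_ineq]) (simp add: norm_mult)
  also have "\<dots> \<le> cmod a * (nrm K h \<phi> * (h ^ mi_size \<alpha> * M (mi_size \<alpha>)))
      + cmod b * (nrm K h \<psi> * (h ^ mi_size \<alpha> * M (mi_size \<alpha>)))"
    by (intro add_mono mult_left_mono mderiv_le_nrm \<phi> \<psi> K x) auto
  also have "\<dots> = (cmod a * nrm K h \<phi> + cmod b * nrm K h \<psi>) * (h ^ mi_size \<alpha> * M (mi_size \<alpha>))"
    by (simp add: algebra_simps)
  finally show ?thesis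
    using K x by (subst mderiv_lincomb[OF \<phi> \<psi>]) (auto simp: adm_def)
qed

lemma E_lincomb:
  assumes \<phi>: "\<phi> \<in> E" and \<psi>: "\<psi> \<in> E"
  shows "(\<lambda>x. a * \<phi> x + b * \<psi> x) \<in> E"
proof -
  have "um_norm M K h (\<lambda>x. a * \<phi> x + b * \<psi> x) < \<infinity>" if K: "adm K h" for K h
  proof -
    have "um_norm M K h (\<lambda>x. a * \<phi> x + b * \<psi> x) \<le> ennreal (cmod a * nrm K h \<phi> + cmod b * nrm K h \<psi>)"
      using K by (intro um_norm_le mderiv_lincomb_le[OF \<phi> \<psi> K]) (auto simp: adm_def nrm_nonneg)
    then show ?thesis by (simp add: order_le_less_trans)
  qed
  then show ?thesis
    using \<phi> \<psi> smooth_on_lincomb[OF open_\<Omega>] by (simp add: beurling_space_def adm_def)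
qed

lemma nrm_lincomb:
  assumes "\<phi> \<in> E" "\<psi> \<in> E" "adm K h"
  shows "nrm K h (\<lambda>x. a * \<phi> x + b * \<psi> x) \<le> cmod a * nrm K h \<phi> + cmod b * nrm K h \<psi>"
  using assms by (intro nrm_le mderiv_lincomb_le) (auto simp: adm_def nrm_nonneg)

lemma E_scale: "\<phi> \<in> E \<Longrightarrow> (\<lambda>x. c * \<phi> x) \<in> E"
  using E_lincomb[of \<phi> \<phi> c 0] by simp

lemma nrm_scale_le: "\<phi> \<in> E \<Longrightarrow> adm K h \<Longrightarrow> nrm K h (\<lambda>x. c * \<phi> x) \<le> cmod c * nrm K h \<phi>"
  using nrm_lincomb[of \<phi> \<phi> K h c 0] by simp

lemma E_zero: "(\<lambda>_. 0) \<in> E"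
proof -
  have "smooth_on \<Omega> (\<lambda>_. 0)" by (simp add: smooth_on_def partials_zero)
  moreover have "um_norm M K h (\<lambda>_. 0) \<le> ennreal 0" if "0 < h" for K :: "(real ^ 'd) set" and h
    using that by (intro um_norm_le) (auto simp: mderiv_def partials_zero)
  ultimately show ?thesis by (simp add: beurling_space_def)
qed

lemma nrm_mono:
  assumes "\<phi> \<in> E" "adm K' h'" "K \<subseteq> K'" "h' \<le> h"
  shows "nrm K h \<phi> \<le> nrm K' h' \<phi>"
proof (rule nrm_le)
  have h: "0 < h'" using assms by (simp add: adm_def)
  then show "0 < h" using assms by simp
  fix \<alpha> x assume "x \<in> K"
  then have "cmod (mderiv \<alpha> \<phi> x) \<le> nrm K' h' \<phi> * (h' ^ mi_size \<alpha> * M (mi_size \<alpha>))"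
    using assms by (intro mderiv_le_nrm) auto
  also have "\<dots> \<le> nrm K' h' \<phi> * (h ^ mi_size \<alpha> * M (mi_size \<alpha>))"
    using h assms M_pos by (intro mult_left_mono mult_right_mono power_mono nrm_nonneg) (auto intro: less_imp_le)
  finally show "cmod (mderiv \<alpha> \<phi> x) \<le> nrm K' h' \<phi> * (h ^ mi_size \<alpha> * M (mi_size \<alpha>))" .
qed (rule nrm_nonneg)

text \<open>A neighbourhood of 0 contains a ball for finitely many of the norms, and scaling by a
  multiple of their bounds moves S into it.\<close>

lemma vn_bounded_beurling:
  assumes S: "S \<subseteq> E" and bd: "\<And>K h. adm K h \<Longrightarrow> \<exists>c. \<forall>\<phi>\<in>S. nrm K h \<phi> \<le> c"
  shows "vn_bounded (beurling_topology M \<Omega>) S"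
  unfolding vn_bounded_def
proof (intro conjI allI impI)
  show "S \<subseteq> topspace (beurling_topology M \<Omega>)" using S by simp
  fix U assume U: "openin (beurling_topology M \<Omega>) U \<and> (\<lambda>_. 0) \<in> U"
  let ?P = "{(\<lambda>\<phi>. enn2real (um_norm M K h \<phi>)) | K h. regular_compact K \<and> K \<subseteq> \<Omega> \<and> h > 0}"
  have P: "\<exists>K h. adm K h \<and> p = nrm K h" if "p \<in> ?P" for p
    using that by (auto simp: adm_def nrm_def fun_eq_iff)
  have sub: "p (\<lambda>t. g t - f t) \<le> p g + p (\<lambda>t. - f t)"
    if p: "p \<in> ?P" and fg: "f \<in> E" "g \<in> E" for p f g
  proof -
    obtain K h where K: "adm K h" "p = nrm K h" using P[OF p] by blast
    have "(\<lambda>t. - f t) \<in> E" using E_scale[OF fg(1), of "-1"] by simp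
    then show ?thesis using nrm_lincomb[OF fg(2) _ K(1), of "\<lambda>t. - f t" 1 1] K by simp
  qed
  obtain F e where F: "finite F" "F \<subseteq> ?P" "0 < e" "{g \<in> E. \<forall>p\<in>F. p g < e} \<subseteq> U"
    by (rule seminorm_topology_nhd_zero[of ?P E U, OF sub])
      (use U in \<open>auto simp: beurling_topology_def\<close>)
  have "\<exists>c. \<forall>\<phi>\<in>S. p \<phi> \<le> c" if "p \<in> F" for p
    using P[OF subsetD[OF F(2) that]] bd by blast
  then obtain c where c: "\<And>p \<phi>. p \<in> F \<Longrightarrow> \<phi> \<in> S \<Longrightarrow> p \<phi> \<le> c p" by metis
  \<comment> \<open>The summand 1 makes r positive even for empty F and the resulting estimate
    strict.\<close>
  define r where "r = (1 + (\<Sum>p\<in>F. \<bar>c p\<bar>)) / e"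
  have r: "0 < r" using F(3) by (simp add: r_def add_pos_nonneg sum_nonneg)
  have "\<phi> \<in> (\<lambda>f t. complex_of_real r * f t) ` U" if \<phi>: "\<phi> \<in> S" for \<phi>
  proof (rule image_eqI)
    let ?\<psi> = "\<lambda>t. complex_of_real (inverse r) * \<phi> t"
    show "\<phi> = (\<lambda>t. complex_of_real r * ?\<psi> t)" using r by (simp add: fun_eq_iff field_simps)
    have "p ?\<psi> < e" if p: "p \<in> F" for p
    proof -
      obtain K h where K: "adm K h" "p = nrm K h" using P[OF subsetD[OF F(2) p]] by blast
      have "p ?\<psi> \<le> cmod (complex_of_real (inverse r)) * p \<phi>"
        unfolding K(2) using S \<phi> by (intro nrm_scale_le K(1)) auto
      also have "\<dots> = inverse r * p \<phi>" using r by (simp add: norm_inverse)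
      also have "\<dots> \<le> inverse r * (\<Sum>p\<in>F. \<bar>c p\<bar>)"
      proof (rule mult_left_mono)
        have "p \<phi> \<le> \<bar>c p\<bar>" using c[OF p \<phi>] by simp
        also have "\<dots> \<le> (\<Sum>p\<in>F. \<bar>c p\<bar>)" using F(1) p by (intro member_le_sum) auto
        finally show "p \<phi> \<le> (\<Sum>p\<in>F. \<bar>c p\<bar>)" .
      qed (use r in auto)
      also have "\<dots> < inverse r * (1 + (\<Sum>p\<in>F. \<bar>c p\<bar>))" using r by (intro mult_strict_left_mono) auto
      also have "\<dots> = e" using r F(3) by (auto simp: r_def)
      finally show ?thesis .
    qed
    then show "?\<psi> \<in> U" using F(4) E_scale S \<phi> by blast
  qed
  then show "\<exists>r>0. S \<subseteq> (\<lambda>f t. complex_of_real r * f t) ` U" using r by blast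
qed

text \<open>The space is metrizable, so if \<open>B\<close> were not equicontinuous there would be a bounded sequence
  in \<open>E\<close> along which \<open>B\<close> is unbounded.\<close>

lemma equicontinuous:
  assumes B: "vn_bounded (strong_dual (beurling_topology M \<Omega>)) B"
  obtains K h C where "adm K h" "0 \<le> C" "\<And>f \<phi>. f \<in> B \<Longrightarrow> \<phi> \<in> E \<Longrightarrow> cmod (f \<phi>) \<le> C * nrm K h \<phi>"
proof -
  obtain L :: "nat \<Rightarrow> (real ^ 'd) set" where L: "\<And>n. regular_compact (L n)" "\<And>n. L n \<subseteq> \<Omega>"
    "\<And>m n. m \<le> n \<Longrightarrow> L m \<subseteq> L n" "\<And>K. compact K \<Longrightarrow> K \<subseteq> \<Omega> \<Longrightarrow> \<exists>n. K \<subseteq> L n"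
    using regular_compact_exhaustion[OF open_\<Omega>] by blast
  \<comment> \<open>A countable cofinal family: each admissible norm is dominated by q n for all
    large n.\<close>
  define q where "q n = nrm (L n) (1 / (real n + 1))" for n
  have adm: "adm (L n) (1 / (real n + 1))" for n using L by (simp add: adm_def)
  have "\<exists>n. \<forall>f\<in>B. \<forall>\<phi>\<in>E. cmod (f \<phi>) \<le> (real n + 1) * q n \<phi>"
  proof (rule ccontr)
    assume "\<nexists>n. \<forall>f\<in>B. \<forall>\<phi>\<in>E. cmod (f \<phi>) \<le> (real n + 1) * q n \<phi>"
    then have "\<forall>n. \<exists>f \<phi>. f \<in> B \<and> \<phi> \<in> E \<and> (real n + 1) * q n \<phi> < cmod (f \<phi>)" by (meson not_le)
    then obtain f \<phi> where f: "\<And>n. f n \<in> B" and \<phi>: "\<And>n. \<phi> n \<in> E"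
      and big: "\<And>n. (real n + 1) * q n (\<phi> n) < cmod (f n (\<phi> n))"
      by metis
    \<comment> \<open>Normalised so that f n takes a value of modulus n + 1 at \<psi> n, while q n
      (\<psi> n) stays at most 1.\<close>
    define s where "s n = (real n + 1) / cmod (f n (\<phi> n))" for n
    define \<psi> where "\<psi> n = (\<lambda>x. complex_of_real (s n) * \<phi> n x)" for n
    have pos: "0 < cmod (f n (\<phi> n))" for n
      using big[of n] by (rule order_le_less_trans[rotated]) (simp add: q_def nrm_nonneg)
    then have s: "0 < s n" for n by (simp add: s_def)
    have \<psi>E: "\<psi> n \<in> E" for n unfolding \<psi>_def by (rule E_scale[OF \<phi>])
    have q\<psi>: "q n (\<psi> n) \<le> 1" for n
    proof -
      have "q n (\<psi> n) \<le> cmod (complex_of_real (s n)) * q n (\<phi> n)"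
        unfolding q_def \<psi>_def by (rule nrm_scale_le[OF \<phi> adm])
      also have "\<dots> = s n * q n (\<phi> n)" using s[of n] by simp
      also have "\<dots> = ((real n + 1) * q n (\<phi> n)) / cmod (f n (\<phi> n))" by (simp add: s_def)
      also have "\<dots> \<le> 1" using big[of n] pos[of n] by (simp add: divide_le_eq)
      finally show ?thesis .
    qed
    have bdd: "vn_bounded (beurling_topology M \<Omega>) (range \<psi>)"
    proof (rule vn_bounded_beurling)
      fix K h assume K: "adm K h"
      then obtain n1 where n1: "K \<subseteq> L n1" using L(4)[of K] by (auto simp: adm_def regular_compact_def)
      obtain n2 where n2: "1 / h < real n2" using reals_Archimedean2 by blast
      have bound: "nrm K h (\<psi> n) \<le> 1" if n: "max n1 n2 \<le> n" for n
      proof -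
        have "1 / h \<le> real n + 1" using n n2 by linarith
        then have "1 / (real n + 1) \<le> h" using K by (simp add: adm_def field_simps)
        moreover have "K \<subseteq> L n" using n1 L(3)[of n1 n] n by auto
        ultimately have "nrm K h (\<psi> n) \<le> q n (\<psi> n)"
          unfolding q_def by (intro nrm_mono[OF \<psi>E adm])
        with q\<psi>[of n] show ?thesis by simp
      qed
      \<comment> \<open>The 1 bounds the tail, where q n dominates; the finitely many earlier terms
        are bounded by their sum.\<close>
      define c where "c = 1 + (\<Sum>n<max n1 n2. nrm K h (\<psi> n))"
      have "nrm K h (\<psi> n) \<le> c" for n
      proof (cases "n < max n1 n2")
        case True
        then have "nrm K h (\<psi> n) \<le> (\<Sum>n<max n1 n2. nrm K h (\<psi> n))"
          by (intro member_le_sum) (auto simp: nrm_nonneg)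
        then show ?thesis by (simp add: c_def)
      next
        case False
        have "0 \<le> (\<Sum>n<max n1 n2. nrm K h (\<psi> n))" by (intro sum_nonneg nrm_nonneg)
        moreover have "nrm K h (\<psi> n) \<le> 1" by (rule bound) (use False in \<open>simp add: not_less\<close>)
        ultimately show ?thesis by (simp add: c_def)
      qed
      then show "\<exists>c. \<forall>\<phi>\<in>range \<psi>. nrm K h \<phi> \<le> c" by blast
    qed (use \<psi>E in auto)
    have "(\<lambda>_. 0) \<in> topspace (beurling_topology M \<Omega>)" using E_zero by simp
    then obtain r where r: "\<And>g \<theta>. g \<in> B \<Longrightarrow> \<theta> \<in> range \<psi> \<Longrightarrow> cmod (g \<theta>) \<le> r"
      using strong_dual_bounded[OF B bdd] by blast
    obtain n where n: "r < real n" using reals_Archimedean2 by blast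
    have "f n \<in> dual_space (beurling_topology M \<Omega>)" using f B by (auto simp: vn_bounded_def)
    then have "f n (\<psi> n) = complex_of_real (s n) * f n (\<phi> n)"
      unfolding \<psi>_def using \<phi> by (simp add: dual_space_def)
    then have "cmod (f n (\<psi> n)) = s n * cmod (f n (\<phi> n))"
      using s[of n] by (simp add: norm_mult)
    also have "\<dots> = real n + 1" using pos[of n] by (simp add: s_def)
    finally have "cmod (f n (\<psi> n)) = real n + 1" .
    with r[OF f[of n], of "\<psi> n"] n show False by simp
  qed
  then obtain n where "\<forall>f\<in>B. \<forall>\<phi>\<in>E. cmod (f \<phi>) \<le> (real n + 1) * q n \<phi>" ..
  then show ?thesis
    by (intro that[OF adm[of n], of "real n + 1"]) (auto simp: q_def)
qed

end

section \<open>Representation by measures\<close>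

definition sup_abs :: "('x \<Rightarrow> real) \<Rightarrow> real" where
  "sup_abs u = (SUP x. \<bar>u x\<bar>)"

lemma abs_le_sup_abs: "bounded (range u) \<Longrightarrow> \<bar>u x\<bar> \<le> sup_abs u"
  unfolding sup_abs_def
  by (rule cSUP_upper) (auto simp: bounded_iff bdd_above_def)

lemma sup_abs_le: "(\<And>x. \<bar>u x\<bar> \<le> b) \<Longrightarrow> sup_abs u \<le> b"
  unfolding sup_abs_def by (rule cSUP_least) auto

lemma bounded_range_add:
  fixes u v :: "'x \<Rightarrow> real"
  shows "bounded (range u) \<Longrightarrow> bounded (range v) \<Longrightarrow> bounded (range (\<lambda>x. u x + v x))"
  by (rule bounded_plus_comp)

lemma bounded_range_scale:
  fixes u :: "'x \<Rightarrow> real"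
  shows "bounded (range u) \<Longrightarrow> bounded (range (\<lambda>x. r * u x))"
  using bounded_scaleR_comp[of u UNIV r] by simp

lemma sup_abs_add:
  assumes "bounded (range u)" "bounded (range v)"
  shows "sup_abs (\<lambda>x. u x + v x) \<le> sup_abs u + sup_abs v"
  by (rule sup_abs_le)
    (use assms in \<open>auto intro: order_trans[OF abs_triangle_ineq] add_mono abs_le_sup_abs\<close>)

lemma sup_abs_scale:
  assumes u: "bounded (range u)" and r: "0 < r"
  shows "sup_abs (\<lambda>x. r * u x) = r * sup_abs u"
proof (rule antisym)
  show "sup_abs (\<lambda>x. r * u x) \<le> r * sup_abs u"
    using r by (intro sup_abs_le) (auto simp: abs_mult intro!: mult_left_mono abs_le_sup_abs u)
  have "sup_abs u \<le> sup_abs (\<lambda>x. r * u x) / r"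
  proof (rule sup_abs_le)
    fix x
    have "\<bar>r * u x\<bar> \<le> sup_abs (\<lambda>x. r * u x)" by (intro abs_le_sup_abs bounded_range_scale u)
    then show "\<bar>u x\<bar> \<le> sup_abs (\<lambda>x. r * u x) / r" using r by (simp add: abs_mult field_simps)
  qed
  then show "r * sup_abs u \<le> sup_abs (\<lambda>x. r * u x)" using r by (simp add: field_simps)
qed

context beurling
begin

text \<open>The functional factors through the normalised real and imaginary parts of all derivatives
  on \<open>K\<close>, viewed as one bounded function of \<open>(\<alpha>, x, b)\<close>. The derivatives decay because the
  norm for \<open>h / 2\<close> is finite as well, which makes the extended functional the sum of
  its restrictions to the slices with fixed \<open>\<alpha>\<close>.\<close>

lemma representation:
  assumes K: "adm K h" and C: "0 \<le> C"
    and f_add: "\<And>\<phi> \<psi>. \<phi> \<in> E \<Longrightarrow> \<psi> \<in> E \<Longrightarrow> f (\<lambda>x. \<phi> x + \<psi> x) = f \<phi> + f \<psi>"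
    and f_scale: "\<And>\<phi> c. \<phi> \<in> E \<Longrightarrow> f (\<lambda>x. c * \<phi> x) = c * f \<phi>"
    and f_le: "\<And>\<phi>. \<phi> \<in> E \<Longrightarrow> cmod (f \<phi>) \<le> C * nrm K h \<phi>"
  obtains \<mu> where "\<And>\<alpha>. complex_measure_on K (\<mu> \<alpha>)"
    "\<And>\<alpha>. total_variation K (\<mu> \<alpha>) \<le> ennreal (12 * C / (h ^ mi_size \<alpha> * M (mi_size \<alpha>)))"
    "\<And>\<phi>. \<phi> \<in> E \<Longrightarrow>
      ((\<lambda>\<alpha>. (-1) ^ mi_size \<alpha> * complex_integral K (\<mu> \<alpha>) (mderiv \<alpha> \<phi>)) has_sum f \<phi>) UNIV"
proof -
  have h: "0 < h" and cK: "compact K" and K\<Omega>: "K \<subseteq> \<Omega>"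
    using K by (auto simp: adm_def regular_compact_def)
  define w where "w \<alpha> = h ^ mi_size \<alpha> * M (mi_size \<alpha>)" for \<alpha> :: "nat ^ 'd"
  have w: "0 < w \<alpha>" for \<alpha> using h M_pos by (simp add: w_def)
  define part where "part b z = (if b then Re z else Im z)" for b z
  have part: "part b (y + z) = part b y + part b z" "part b (complex_of_real r * z) = r * part b z"
    "\<bar>part b z\<bar> \<le> cmod z" for b y z r
    by (auto simp: part_def abs_Re_le_cmod abs_Im_le_cmod)
  \<comment> \<open>Extension by 0 off K makes the supremum over the whole type the right
    norm.\<close>
  define \<Phi> where "\<Phi> \<phi> = (\<lambda>(\<alpha>, x, b). if x \<in> K then part b (mderiv \<alpha> \<phi> x) / w \<alpha> else 0)" for \<phi>
  have \<Phi>_le: "\<bar>\<Phi> \<phi> z\<bar> \<le> nrm K h \<phi>" if "\<phi> \<in> E" for \<phi> z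
  proof -
    obtain \<alpha> x b where z: "z = (\<alpha>, x, b)" by (cases z) auto
    have "\<bar>part b (mderiv \<alpha> \<phi> x)\<bar> \<le> nrm K h \<phi> * w \<alpha>" if "x \<in> K"
      using part(3) mderiv_le_nrm[OF \<open>\<phi> \<in> E\<close> K that, of \<alpha>] by (auto simp: w_def intro: order_trans)
    then show ?thesis using w[of \<alpha>] nrm_nonneg by (auto simp: \<Phi>_def z divide_le_eq)
  qed
  have \<Phi>_bd: "bounded (range (\<Phi> \<phi>))" if "\<phi> \<in> E" for \<phi>
    using \<Phi>_le[OF that] by (auto simp: bounded_iff)
  \<comment> \<open>The factor 2 comes from bounding a modulus by the sum of its real and imaginary
    parts; it reappears in \<open>p\<close>.\<close>
  have nrm_le_\<Phi>: "nrm K h \<phi> \<le> 2 * sup_abs (\<Phi> \<phi>)" if "\<phi> \<in> E" for \<phi>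
  proof (rule nrm_le[OF h])
    have "0 \<le> \<bar>\<Phi> \<phi> undefined\<bar>" by simp
    also have "\<dots> \<le> sup_abs (\<Phi> \<phi>)" by (rule abs_le_sup_abs[OF \<Phi>_bd[OF that]])
    finally show "0 \<le> 2 * sup_abs (\<Phi> \<phi>)" by simp
    fix \<alpha> x assume x: "x \<in> K"
    have *: "\<bar>part b (mderiv \<alpha> \<phi> x)\<bar> \<le> sup_abs (\<Phi> \<phi>) * w \<alpha>" for b
      using abs_le_sup_abs[OF \<Phi>_bd[OF that], of "(\<alpha>, x, b)"] x w[of \<alpha>]
      by (simp add: \<Phi>_def divide_le_eq)
    have "cmod (mderiv \<alpha> \<phi> x) \<le> \<bar>part True (mderiv \<alpha> \<phi> x)\<bar> + \<bar>part False (mderiv \<alpha> \<phi> x)\<bar>"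
      using cmod_le[of "mderiv \<alpha> \<phi> x"] by (simp add: part_def)
    then show "cmod (mderiv \<alpha> \<phi> x) \<le> 2 * sup_abs (\<Phi> \<phi>) * (h ^ mi_size \<alpha> * M (mi_size \<alpha>))"
      using *[of True] *[of False] by (simp add: w_def)
  qed
  have \<Phi>_lincomb: "\<Phi> (\<lambda>x. complex_of_real r * \<phi> x + complex_of_real s * \<psi> x) = (\<lambda>z. r * \<Phi> \<phi> z + s * \<Phi> \<psi> z)"
    if "\<phi> \<in> E" "\<psi> \<in> E" for \<phi> \<psi> r s
    using K\<Omega> mderiv_lincomb[OF that]
    by (auto simp: \<Phi>_def fun_eq_iff part add_divide_distrib)
  define W where "W = {u :: (nat ^ 'd) \<times> (real ^ 'd) \<times> bool \<Rightarrow> real. bounded (range u)}"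
  define p where "p u = 2 * C * sup_abs u" for u :: "(nat ^ 'd) \<times> (real ^ 'd) \<times> bool \<Rightarrow> real"
  define R where "R = {(\<Phi> \<phi>, Re (f \<phi>)) | \<phi>. \<phi> \<in> E}"
  have R_I: "(u, a) \<in> R" if "\<phi> \<in> E" "u = \<Phi> \<phi>" "a = Re (f \<phi>)" for u a \<phi>
    using that by (auto simp: R_def)
  have R_lincomb: "((\<lambda>z. r * u z + s * v z), r * a + s * b) \<in> R"
    if "(u, a) \<in> R" "(v, b) \<in> R" for u v a b r s
  proof -
    obtain \<phi> \<psi> where *: "\<phi> \<in> E" "u = \<Phi> \<phi>" "a = Re (f \<phi>)" "\<psi> \<in> E" "v = \<Phi> \<psi>" "b = Re (f \<psi>)"
      using \<open>(u, a) \<in> R\<close> \<open>(v, b) \<in> R\<close> by (auto simp: R_def)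
    let ?\<theta> = "\<lambda>x. complex_of_real r * \<phi> x + complex_of_real s * \<psi> x"
    show ?thesis
    proof (rule R_I[of ?\<theta>])
      show "?\<theta> \<in> E" by (intro E_lincomb *)
      show "(\<lambda>z. r * u z + s * v z) = \<Phi> ?\<theta>" using * by (simp add: \<Phi>_lincomb)
      have "f ?\<theta> = complex_of_real r * f \<phi> + complex_of_real s * f \<psi>"
        using * by (simp add: f_add f_scale E_scale)
      then show "r * a + s * b = Re (f ?\<theta>)" using * by simp
    qed
  qed
  have R_zero: "((\<lambda>_. 0), 0) \<in> R"
  proof -
    have "(\<Phi> (\<lambda>_. 0), Re (f (\<lambda>_. 0))) \<in> R" using E_zero by (auto simp: R_def)
    from R_lincomb[OF this this, of 0 0] show ?thesis by simp
  qed
  obtain F where F_R: "\<And>u a. (u, a) \<in> R \<Longrightarrow> F u = a"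
    and F_add: "\<And>u v. u \<in> W \<Longrightarrow> v \<in> W \<Longrightarrow> F (\<lambda>x. u x + v x) = F u + F v"
    and F_scale: "\<And>u r. u \<in> W \<Longrightarrow> F (\<lambda>x. r * u x) = r * F u"
    and F_p: "\<And>u. u \<in> W \<Longrightarrow> F u \<le> p u"
  proof (rule hahn_banach_functions[of W p R])
    show "p (\<lambda>x. u x + v x) \<le> p u + p v" if "u \<in> W" "v \<in> W" for u v
      using sup_abs_add[of u v] that C by (simp add: p_def W_def mult_left_mono flip: distrib_left)
    show "p (\<lambda>x. r * u x) = r * p u" if "u \<in> W" "0 < r" for u r
      using that by (simp add: p_def W_def sup_abs_scale)
    show "R \<subseteq> W \<times> UNIV" using \<Phi>_bd by (auto simp: R_def W_def)
    show "((\<lambda>x. u x + v x), a + b) \<in> R" if "(u, a) \<in> R" "(v, b) \<in> R" for u v a b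
      using R_lincomb[OF that, of 1 1] by simp
    show "((\<lambda>x. r * u x), r * a) \<in> R" if "(u, a) \<in> R" for u a r
      using R_lincomb[OF that that, of r 0] by simp
    show "a \<le> p u" if ua: "(u, a) \<in> R" for u a
    proof -
      obtain \<phi> where \<phi>: "\<phi> \<in> E" "u = \<Phi> \<phi>" "a = Re (f \<phi>)" using ua by (auto simp: R_def)
      have "a \<le> cmod (f \<phi>)" using \<phi> complex_Re_le_cmod by simp
      also have "\<dots> \<le> C * nrm K h \<phi>" by (rule f_le[OF \<phi>(1)])
      also have "\<dots> \<le> C * (2 * sup_abs (\<Phi> \<phi>))" by (intro mult_left_mono nrm_le_\<Phi> \<phi> C)
      finally show ?thesis using \<phi> by (simp add: p_def)
    qed
  qed (auto simp: W_def intro: bounded_range_add bounded_range_scale R_zero)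
  have W_I: "u \<in> W" if "\<And>z. \<bar>u z\<bar> \<le> b" for u b
    using that by (auto simp: W_def bounded_iff)
  have F_abs: "\<bar>F u\<bar> \<le> 2 * C * b" if b: "\<And>z. \<bar>u z\<bar> \<le> b" for u b
  proof -
    have uW: "u \<in> W" by (rule W_I[OF b])
    have *: "F v \<le> 2 * C * b" if "v \<in> W" "\<And>z. \<bar>v z\<bar> \<le> b" for v
    proof -
      have "F v \<le> 2 * C * sup_abs v" using F_p[OF that(1)] by (simp add: p_def)
      also have "\<dots> \<le> 2 * C * b" by (intro mult_left_mono sup_abs_le that) (use C in auto)
      finally show ?thesis .
    qed
    have "F (\<lambda>z. (-1) * u z) \<le> 2 * C * b"
      by (rule *[OF W_I[of _ b]]) (use b in auto)
    then have "- F u \<le> 2 * C * b" using F_scale[OF uW, of "-1"] by simp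
    then show ?thesis using *[OF uW b] by (simp add: abs_le_iff)
  qed
  have F_0: "F (\<lambda>_. 0) = 0" using F_abs[of "\<lambda>_. 0" 0] by simp
  \<comment> \<open>The sign is built in to cancel the one in the series, and dividing by w \<alpha>
    matches the normalisation in \<Phi>; it is also the source of the decay of the measures.\<close>
  define slice where "slice \<alpha> b u = (\<lambda>(\<beta>, x, c). if \<beta> = \<alpha> \<and> c = b \<and> x \<in> K
      then (-1) ^ mi_size \<alpha> / w \<alpha> * u x else 0)" for \<alpha> and b :: bool and u :: "real ^ 'd \<Rightarrow> real"
  define J where "J \<alpha> b u = F (slice \<alpha> b u)" for \<alpha> b u
  have slice_le: "\<bar>slice \<alpha> b u z\<bar> \<le> B / w \<alpha>" if "\<And>x. x \<in> K \<Longrightarrow> \<bar>u x\<bar> \<le> B" "0 \<le> B" for \<alpha> b u z B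
    using that w[of \<alpha>] by (auto simp: slice_def abs_mult divide_right_mono split: prod.splits)
  have slice_W: "slice \<alpha> b u \<in> W" if u: "continuous_on K u" for \<alpha> b u
  proof -
    have "bounded (u ` K)" using u cK by (simp add: compact_continuous_image compact_imp_bounded)
    then obtain B where "0 < B" "\<forall>x\<in>K. \<bar>u x\<bar> \<le> B" by (auto simp: bounded_pos)
    then show ?thesis by (intro W_I[of _ "B / w \<alpha>"] slice_le) auto
  qed
  have J_add: "J \<alpha> b (\<lambda>x. u x + v x) = J \<alpha> b u + J \<alpha> b v"
    if "continuous_on K u" "continuous_on K v" for \<alpha> b u v
  proof -
    have "slice \<alpha> b (\<lambda>x. u x + v x) = (\<lambda>z. slice \<alpha> b u z + slice \<alpha> b v z)"
      by (auto simp: slice_def fun_eq_iff distrib_left)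
    then show ?thesis using F_add[OF slice_W slice_W] that by (simp add: J_def)
  qed
  have J_scale: "J \<alpha> b (\<lambda>x. r * u x) = r * J \<alpha> b u" if "continuous_on K u" for \<alpha> b u r
  proof -
    have "slice \<alpha> b (\<lambda>x. r * u x) = (\<lambda>z. r * slice \<alpha> b u z)"
      by (auto simp: slice_def fun_eq_iff)
    then show ?thesis using F_scale[OF slice_W] that by (simp add: J_def)
  qed
  have J_bound: "\<bar>J \<alpha> b u\<bar> \<le> (2 * C / w \<alpha>) * B" if "0 \<le> B" "\<And>x. x \<in> K \<Longrightarrow> \<bar>u x\<bar> \<le> B" for \<alpha> b u B
    using F_abs[OF slice_le[OF that(2,1)]] by (simp add: J_def)
  have "\<exists>\<mu>. complex_measure_on K \<mu> \<and> total_variation K \<mu> \<le> ennreal (6 * (2 * C / w \<alpha>)) \<and>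
    (\<forall>u. continuous_on K u \<longrightarrow> complex_integral K \<mu> u =
      Complex (J \<alpha> True (\<lambda>x. Re (u x)) + J \<alpha> False (\<lambda>x. Im (u x)))
        (J \<alpha> True (\<lambda>x. Im (u x)) - J \<alpha> False (\<lambda>x. Re (u x))))" for \<alpha>
  proof -
    have c: "0 \<le> 2 * C / w \<alpha>" using C w[of \<alpha>] by simp
    show ?thesis
      by (rule riesz_representation_complex[OF cK c, of "J \<alpha> True" "J \<alpha> False"])
        (use J_add J_scale J_bound in blast)+
  qed
  then obtain \<mu> where \<mu>: "\<And>\<alpha>. complex_measure_on K (\<mu> \<alpha>)"
    "\<And>\<alpha>. total_variation K (\<mu> \<alpha>) \<le> ennreal (6 * (2 * C / w \<alpha>))"
    "\<And>\<alpha> u. continuous_on K u \<Longrightarrow> complex_integral K (\<mu> \<alpha>) u =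
      Complex (J \<alpha> True (\<lambda>x. Re (u x)) + J \<alpha> False (\<lambda>x. Im (u x)))
        (J \<alpha> True (\<lambda>x. Im (u x)) - J \<alpha> False (\<lambda>x. Re (u x)))"
    by metis
  \<comment> \<open>The real part of the \<alpha>-th term of the series, by the formula for
    \<open>complex_integral\<close>.\<close>
  define G where "G \<phi> \<alpha> = (-1) ^ mi_size \<alpha> *
    (J \<alpha> True (\<lambda>x. Re (mderiv \<alpha> \<phi> x)) + J \<alpha> False (\<lambda>x. Im (mderiv \<alpha> \<phi> x)))" for \<phi> \<alpha>
  have cont: "continuous_on K (mderiv \<alpha> \<phi>)" if "\<phi> \<in> E" for \<alpha> \<phi>
    using that K\<Omega> unfolding mderiv_def
    by (auto simp: beurling_space_def smooth_on_def intro: continuous_on_subset)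
  have contRe: "continuous_on K (\<lambda>x. Re (mderiv \<alpha> \<phi> x))"
    and contIm: "continuous_on K (\<lambda>x. Im (mderiv \<alpha> \<phi> x))" if "\<phi> \<in> E" for \<alpha> \<phi>
    by (intro continuous_on_Re continuous_on_Im cont that)+
  define cut where "cut S u = (\<lambda>z. if fst z \<in> S then u z else 0)"
    for S and u :: "(nat ^ 'd) \<times> (real ^ 'd) \<times> bool \<Rightarrow> real"
  have cut_W: "cut S (\<Phi> \<phi>) \<in> W" if "\<phi> \<in> E" for S \<phi>
    by (rule W_I[of _ "nrm K h \<phi>"]) (use \<Phi>_le[OF that] nrm_nonneg in \<open>auto simp: cut_def\<close>)
  have G_cut: "G \<phi> \<alpha> = F (cut {\<alpha>} (\<Phi> \<phi>))" if \<phi>: "\<phi> \<in> E" for \<phi> \<alpha>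
  proof -
    let ?s1 = "slice \<alpha> True (\<lambda>x. Re (mderiv \<alpha> \<phi> x))" and ?s2 = "slice \<alpha> False (\<lambda>x. Im (mderiv \<alpha> \<phi> x))"
    have W12: "?s1 \<in> W" "?s2 \<in> W" by (intro slice_W contRe contIm \<phi>)+
    have "cut {\<alpha>} (\<Phi> \<phi>) = (\<lambda>z. (-1) ^ mi_size \<alpha> * (?s1 z + ?s2 z))"
      by (auto simp: cut_def \<Phi>_def slice_def part_def fun_eq_iff simp flip: mult.assoc power_add)
    moreover have "(\<lambda>z. ?s1 z + ?s2 z) \<in> W" using W12 bounded_range_add by (simp add: W_def)
    ultimately show ?thesis
      using F_scale F_add[OF W12] by (simp add: G_def J_def)
  qed
  have sum_G: "(\<Sum>\<alpha>\<in>S. G \<phi> \<alpha>) = F (cut S (\<Phi> \<phi>))" if \<phi>: "\<phi> \<in> E" and "finite S" for \<phi> S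
    using \<open>finite S\<close>
  proof induction
    case empty
    then show ?case using F_0 by (simp add: cut_def)
  next
    case (insert \<alpha> S)
    have "cut (insert \<alpha> S) (\<Phi> \<phi>) = (\<lambda>z. cut {\<alpha>} (\<Phi> \<phi>) z + cut S (\<Phi> \<phi>) z)"
      using insert(2) by (auto simp: cut_def fun_eq_iff)
    then show ?case using insert F_add[OF cut_W[OF \<phi>] cut_W[OF \<phi>]] by (simp add: G_cut \<phi>)
  qed
  have has_sum_Re: "(G \<phi> has_sum Re (f \<phi>)) UNIV" if \<phi>: "\<phi> \<in> E" for \<phi>
    unfolding has_sum_def tendsto_iff
  proof (intro allI impI)
    fix e :: real assume e: "0 < e"
    \<comment> \<open>Normalising with h an estimate that holds for h / 2 leaves the factor
      2^(-|\<alpha>|).\<close>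
    have K2: "adm K (h / 2)" using K by (simp add: adm_def)
    define A where "A = nrm K (h / 2) \<phi>"
    have A: "0 \<le> A" by (simp add: A_def nrm_nonneg)
    have decay: "\<bar>\<Phi> \<phi> z\<bar> \<le> A * (1/2) ^ mi_size (fst z)" for z
    proof -
      obtain \<alpha> x b where z: "z = (\<alpha>, x, b)" by (cases z) auto
      have "\<bar>part b (mderiv \<alpha> \<phi> x)\<bar> \<le> A * (1/2) ^ mi_size \<alpha> * w \<alpha>" if x: "x \<in> K"
        using order_trans[OF part(3) mderiv_le_nrm[OF \<phi> K2 x, of \<alpha>], of b]
        by (simp add: A_def w_def power_divide)
      then show ?thesis using w[of \<alpha>] A by (auto simp: \<Phi>_def z divide_le_eq)
    qed
    \<comment> \<open>The remainder is at most 2 C A / 2^n; the 1 avoids division by 0.\<close>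
    obtain n where n: "(1/2) ^ n < e / (2 * C * A + 1)"
      using real_arch_pow_inv[of "e / (2 * C * A + 1)" "1/2"] e A C by (auto simp: add_nonneg_pos)
    show "\<forall>\<^sub>F S in finite_subsets_at_top UNIV. dist (sum (G \<phi>) S) (Re (f \<phi>)) < e"
      unfolding eventually_finite_subsets_at_top
    proof (intro exI conjI allI impI)
      show "finite {\<alpha> :: nat ^ 'd. mi_size \<alpha> \<le> n}" by (rule finite_mi_size_le)
      fix S assume S: "finite S \<and> {\<alpha> :: nat ^ 'd. mi_size \<alpha> \<le> n} \<subseteq> S \<and> S \<subseteq> UNIV"
      have "Re (f \<phi>) = F (\<Phi> \<phi>)" using F_R[OF R_I[OF \<phi> refl refl]] by simp
      also have "\<Phi> \<phi> = (\<lambda>z. cut S (\<Phi> \<phi>) z + cut (- S) (\<Phi> \<phi>) z)"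
        by (auto simp: cut_def fun_eq_iff)
      also have "F \<dots> = sum (G \<phi>) S + F (cut (- S) (\<Phi> \<phi>))"
        using S by (subst F_add[OF cut_W[OF \<phi>] cut_W[OF \<phi>]]) (simp add: sum_G[OF \<phi>])
      finally have eq: "Re (f \<phi>) = sum (G \<phi>) S + F (cut (- S) (\<Phi> \<phi>))" .
      have "\<bar>cut (- S) (\<Phi> \<phi>) z\<bar> \<le> A * (1/2) ^ n" for z
      proof (cases "fst z \<in> S")
        case True
        then show ?thesis using A by (simp add: cut_def)
      next
        case False
        then have "n \<le> mi_size (fst z)" using S by (meson mem_Collect_eq nle_le subsetD)
        then have "A * (1/2) ^ mi_size (fst z) \<le> A * (1/2) ^ n"
          using A by (intro mult_left_mono power_decreasing) auto
        then show ?thesis using decay[of z] False by (simp add: cut_def)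
      qed
      then have "\<bar>F (cut (- S) (\<Phi> \<phi>))\<bar> \<le> 2 * C * (A * (1/2) ^ n)" by (rule F_abs)
      also have "\<dots> \<le> (2 * C * A) * (e / (2 * C * A + 1))"
        using n A C by (simp only: mult.assoc[symmetric]) (intro mult_left_mono, auto)
      also have "\<dots> < e"
      proof -
        have D: "0 \<le> 2 * C * A" using A C by simp
        have "x * (e / (x + 1)) < e" if "0 \<le> x" for x using e that by (simp add: field_simps)
        from this[OF D] show ?thesis .
      qed
      finally show "dist (sum (G \<phi>) S) (Re (f \<phi>)) < e" by (simp add: eq dist_real_def)
    qed simp
  qed
  show ?thesis
  proof (rule that)
    show "complex_measure_on K (\<mu> \<alpha>)" for \<alpha> by (rule \<mu>(1))
    show "total_variation K (\<mu> \<alpha>) \<le> ennreal (12 * C / (h ^ mi_size \<alpha> * M (mi_size \<alpha>)))" for \<alpha>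
      using \<mu>(2)[of \<alpha>] by (simp add: w_def)
    fix \<phi> assume \<phi>: "\<phi> \<in> E"
    have i\<phi>: "(\<lambda>x. \<i> * \<phi> x) \<in> E" by (rule E_scale[OF \<phi>])
    \<comment> \<open>Multiplication by i turns Re into -Im and Im into Re, so the real series at i
      \<phi> yields the imaginary parts of the terms up to sign.\<close>
    have G_i: "G (\<lambda>x. \<i> * \<phi> x) \<alpha> = - ((-1) ^ mi_size \<alpha> *
        (J \<alpha> True (\<lambda>x. Im (mderiv \<alpha> \<phi> x)) - J \<alpha> False (\<lambda>x. Re (mderiv \<alpha> \<phi> x))))" for \<alpha>
    proof -
      have m: "mderiv \<alpha> (\<lambda>x. \<i> * \<phi> x) x = \<i> * mderiv \<alpha> \<phi> x" if "x \<in> K" for x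
        using mderiv_lincomb[OF \<phi> \<phi>, of x \<alpha> \<i> 0] that K\<Omega> by auto
      have "slice \<alpha> True (\<lambda>x. Re (mderiv \<alpha> (\<lambda>x. \<i> * \<phi> x) x)) = slice \<alpha> True (\<lambda>x. (-1) * Im (mderiv \<alpha> \<phi> x))"
        "slice \<alpha> False (\<lambda>x. Im (mderiv \<alpha> (\<lambda>x. \<i> * \<phi> x) x)) = slice \<alpha> False (\<lambda>x. Re (mderiv \<alpha> \<phi> x))"
        using m by (auto simp: slice_def fun_eq_iff)
      then have "J \<alpha> True (\<lambda>x. Re (mderiv \<alpha> (\<lambda>x. \<i> * \<phi> x) x)) = J \<alpha> True (\<lambda>x. (-1) * Im (mderiv \<alpha> \<phi> x))"
        "J \<alpha> False (\<lambda>x. Im (mderiv \<alpha> (\<lambda>x. \<i> * \<phi> x) x)) = J \<alpha> False (\<lambda>x. Re (mderiv \<alpha> \<phi> x))"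
        by (simp_all only: J_def)
      then show ?thesis
        using J_scale[OF contIm[OF \<phi>], of \<alpha> True "-1" \<alpha>] by (simp add: G_def algebra_simps)
    qed
    have "((\<lambda>\<alpha>. complex_of_real (G \<phi> \<alpha>) + (- \<i>) * complex_of_real (G (\<lambda>x. \<i> * \<phi> x) \<alpha>)) has_sum
        complex_of_real (Re (f \<phi>)) + (- \<i>) * complex_of_real (Re (f (\<lambda>x. \<i> * \<phi> x)))) UNIV"
      by (intro has_sum_add has_sum_cmult_right has_sum_of_real has_sum_Re \<phi> i\<phi>)
    moreover have "complex_of_real (G \<phi> \<alpha>) + (- \<i>) * complex_of_real (G (\<lambda>x. \<i> * \<phi> x) \<alpha>)
      = (-1) ^ mi_size \<alpha> * complex_integral K (\<mu> \<alpha>) (mderiv \<alpha> \<phi>)" for \<alpha>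
    proof -
      have "(-1) ^ mi_size \<alpha> = complex_of_real ((-1) ^ mi_size \<alpha>)" by simp
      then show ?thesis
        unfolding \<mu>(3)[OF cont[OF \<phi>]] G_i by (simp add: G_def complex_eq_iff del: of_real_power)
    qed
    moreover have "complex_of_real (Re (f \<phi>)) + (- \<i>) * complex_of_real (Re (f (\<lambda>x. \<i> * \<phi> x))) = f \<phi>"
      by (simp add: f_scale \<phi> complex_eq_iff)
    ultimately show "((\<lambda>\<alpha>. (-1) ^ mi_size \<alpha> * complex_integral K (\<mu> \<alpha>) (mderiv \<alpha> \<phi>)) has_sum f \<phi>) UNIV"
      by simp
  qed
qed

end

theorem proposition4p1:
  fixes M :: "nat \<Rightarrow> real"
    and \<Omega> :: "(real ^ 'd::finite) set"
    and B :: "((real ^ 'd \<Rightarrow> complex) \<Rightarrow> complex) set"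
  assumes "weight_sequence M" and "cond_M1 M" and "cond_M2' M" and "cond_QA M" and "fact_prec M"
    and "open \<Omega>"
    and "vn_bounded (strong_dual (beurling_topology M \<Omega>)) B"
  shows "\<exists>K (\<mu> :: ((real ^ 'd \<Rightarrow> complex) \<Rightarrow> complex) \<Rightarrow> nat ^ 'd \<Rightarrow> (real ^ 'd) set \<Rightarrow> complex).
    compact K \<and> K \<subseteq> \<Omega> \<and>
    (\<forall>f\<in>B. \<forall>\<alpha>. complex_measure_on K (\<mu> f \<alpha>)) \<and>
    (\<exists>h>0. (SUP f\<in>B. SUP \<alpha>.
        total_variation K (\<mu> f \<alpha>) * ennreal (M (mi_size \<alpha>) / h ^ mi_size \<alpha>)) < \<infinity>) \<and>
    (\<forall>f\<in>B. \<forall>\<phi>\<in>beurling_space M \<Omega>.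
      ((\<lambda>\<alpha>. (-1) ^ mi_size \<alpha> * complex_integral K (\<mu> f \<alpha>) (mderiv \<alpha> \<phi>)) has_sum f \<phi>) UNIV)"
proof -
  interpret beurling M \<Omega>
    using assms(1,6) by unfold_locales (auto simp: weight_sequence_def)
  obtain K h C where K: "adm K h" and C: "0 \<le> C"
    and eq: "\<And>f \<phi>. f \<in> B \<Longrightarrow> \<phi> \<in> E \<Longrightarrow> cmod (f \<phi>) \<le> C * nrm K h \<phi>"
    using equicontinuous[OF assms(7)] by blast
  have h: "0 < h" using K by (simp add: adm_def)
  define rep where "rep f \<mu> \<longleftrightarrow> (\<forall>\<alpha>. complex_measure_on K (\<mu> \<alpha>)) \<and>
     (\<forall>\<alpha>. total_variation K (\<mu> \<alpha>) \<le> ennreal (12 * C / (h ^ mi_size \<alpha> * M (mi_size \<alpha>)))) \<and>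
     (\<forall>\<phi>\<in>E. ((\<lambda>\<alpha>. (-1) ^ mi_size \<alpha> * complex_integral K (\<mu> \<alpha>) (mderiv \<alpha> \<phi>)) has_sum f \<phi>) UNIV)"
    for f and \<mu> :: "nat ^ 'd \<Rightarrow> (real ^ 'd) set \<Rightarrow> complex"
  have "\<exists>\<mu>. rep f \<mu>" if f: "f \<in> B" for f
  proof -
    have "f \<in> dual_space (beurling_topology M \<Omega>)"
      using f assms(7) by (auto simp: vn_bounded_def)
    then have "f (\<lambda>x. \<phi> x + \<psi> x) = f \<phi> + f \<psi>" "f (\<lambda>x. c * \<phi> x) = c * f \<phi>"
      if "\<phi> \<in> E" "\<psi> \<in> E" for \<phi> \<psi> c
      using that by (simp_all add: dual_space_def)
    then obtain \<mu> where "\<And>\<alpha>. complex_measure_on K (\<mu> \<alpha>)"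
      "\<And>\<alpha>. total_variation K (\<mu> \<alpha>) \<le> ennreal (12 * C / (h ^ mi_size \<alpha> * M (mi_size \<alpha>)))"
      "\<And>\<phi>. \<phi> \<in> E \<Longrightarrow>
        ((\<lambda>\<alpha>. (-1) ^ mi_size \<alpha> * complex_integral K (\<mu> \<alpha>) (mderiv \<alpha> \<phi>)) has_sum f \<phi>) UNIV"
      using representation[OF K C _ _ eq[OF f]] by blast
    then have "rep f \<mu>" by (simp add: rep_def)
    then show ?thesis by (rule exI[of "rep f" \<mu>])
  qed
  then obtain \<mu> where rep: "rep f (\<mu> f)" if "f \<in> B" for f by metis
  have \<mu>: "complex_measure_on K (\<mu> f \<alpha>)"
    "total_variation K (\<mu> f \<alpha>) \<le> ennreal (12 * C / (h ^ mi_size \<alpha> * M (mi_size \<alpha>)))"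
    "\<phi> \<in> E \<Longrightarrow>
      ((\<lambda>\<alpha>. (-1) ^ mi_size \<alpha> * complex_integral K (\<mu> f \<alpha>) (mderiv \<alpha> \<phi>)) has_sum f \<phi>) UNIV"
    if "f \<in> B" for f \<alpha> \<phi>
    using rep[OF that] by (simp_all add: rep_def)
  \<comment> \<open>The h of the norm occurs in the denominator of the bound on the measures, so the
    number asked for in the claim is its reciprocal.\<close>
  have "(SUP f\<in>B. SUP \<alpha>. total_variation K (\<mu> f \<alpha>) * ennreal (M (mi_size \<alpha>) / (1 / h) ^ mi_size \<alpha>))
      \<le> ennreal (12 * C)"
  proof (intro SUP_least)
    fix f and \<alpha> :: "nat ^ 'd" assume f: "f \<in> B"
    have pos: "0 < h ^ mi_size \<alpha> * M (mi_size \<alpha>)" using h M_pos by simp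
    have "total_variation K (\<mu> f \<alpha>) * ennreal (M (mi_size \<alpha>) / (1 / h) ^ mi_size \<alpha>)
      \<le> ennreal (12 * C / (h ^ mi_size \<alpha> * M (mi_size \<alpha>))) * ennreal (h ^ mi_size \<alpha> * M (mi_size \<alpha>))"
      using \<mu>(2)[OF f] by (intro mult_mono) (auto simp: power_one_over mult.commute)
    also have "\<dots> = ennreal (12 * C / (h ^ mi_size \<alpha> * M (mi_size \<alpha>)) * (h ^ mi_size \<alpha> * M (mi_size \<alpha>)))"
      using pos C by (intro ennreal_mult[symmetric]) auto
    also have "\<dots> = ennreal (12 * C)"
      using nonzero_eq_divide_eq[of "h ^ mi_size \<alpha> * M (mi_size \<alpha>)" "12 * C / (h ^ mi_size \<alpha> * M (mi_size \<alpha>))" "12 * C"] pos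
      by (metis less_irrefl)
    finally show "total_variation K (\<mu> f \<alpha>) * ennreal (M (mi_size \<alpha>) / (1 / h) ^ mi_size \<alpha>) \<le> ennreal (12 * C)" .
  qed
  then have "(SUP f\<in>B. SUP \<alpha>. total_variation K (\<mu> f \<alpha>) * ennreal (M (mi_size \<alpha>) / (1 / h) ^ mi_size \<alpha>)) < \<infinity>"
    by (simp add: order_le_less_trans)
  moreover have "compact K" "K \<subseteq> \<Omega>" "0 < 1 / h"
    using K by (auto simp: adm_def regular_compact_def)
  ultimately show ?thesis
    by (intro exI[of _ K] exI[of _ \<mu>] conjI ballI allI exI[of _ "1 / h"]) (simp_all add: \<mu>)
qed

end
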